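(* Let $D$ be a dcpo with an apartness relation $\sharp$. (i) If $D$ has elements $x\sqsubset y$ (i.e. $x$ strictly below $y$), then tightness of $\sharp$ implies excluded middle. (ii) If $D$ has elements $x\sqsubseteq y$ with $x\mathrel{\sharp}y$, then cotransitivity of $\sharp$ implies weak excluded middle.
   Context: Everything is constructive: neither excluded middle nor choice is assumed. Excluded middle: $P\vee\lnot P$ for every proposition $P$. Weak excluded middle: $\lnot P\vee\lnot\lnot P$ for every proposition $P$. A subset $S$ of a poset is directed if it is inhabited and any two elements of $S$ have an upper bound in $S$. A dcpo is a poset $(D,\sqsubseteq)$ in which every directed subset $S$ has a supremum $\bigsqcup S$. An apartness on a set $X$ is merely an irreflexive and symmetric binary relation $\sharp$ on $X$. It is tight if $\lnot(x\mathrel{\sharp}y)$ implies $x=y$ for all $x,y\in X$; it is cotransitive if $x\mathrel{\sharp}y$ implies $x\mathrel{\sharp}z$ or $y\mathrel{\sharp}z$ for all $x,y,z\in X$. For elements of a dcpo $D$, $x$ is strictly below $y$, written $x\sqsubset y$, if $x\sqsubseteq y$ and for every $z\in D$ with $y\sqsubseteq z$ and every proposition $P$, the equality $z=\bigsqcup(\{x\}\cup\{z\mid P\})$ implies $P$. Here $\{z\mid P\}$ is the set whose elements are those $w$ with $w=z$ and $P$ true; the set $\{x\}\cup\{z\mid P\}$ is directed since $x\sqsubseteq z$. *)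

theory Defs
  imports Main
begin

text \<open>
  In HOL excluded middle is a theorem, so a statement of the form ``... implies excluded middle''
  has no content when it is read directly in HOL. The constructive metatheory is therefore an object
  of study here: intuitionistic higher-order logic (the logic of toposes) is defined as a calculus,
  and the mathematical notions below are formulas of that calculus.
\<close>

section \<open>Intuitionistic higher-order logic\<close>

text \<open>
  Simple types over arbitrary base types and a type \<open>Prop\<close> of propositions. A subset of \<open>\<tau>\<close> is a
  term of type \<open>\<tau> \<rightarrow> Prop\<close>. No base type is assumed to be inhabited.
\<close>

datatype ty = Base nat | Prop | Fun ty ty (infixr "\<rightarrow>" 200)

text \<open>De Bruijn terms; formulas are the terms of type \<open>Prop\<close>.\<close>

datatype tm =
    Var nat
  | App tm tm
  | Lam ty tm
  | Eq tm tm
  | Fls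
  | Conj tm tm
  | Disj tm tm
  | Imp tm tm
  | All ty tm
  | Ex ty tm

primrec lift :: "tm \<Rightarrow> nat \<Rightarrow> tm" where
  "lift (Var i) k = (if i < k then Var i else Var (Suc i))"
| "lift (App s t) k = App (lift s k) (lift t k)"
| "lift (Lam \<tau> t) k = Lam \<tau> (lift t (Suc k))"
| "lift (Eq s t) k = Eq (lift s k) (lift t k)"
| "lift Fls k = Fls"
| "lift (Conj s t) k = Conj (lift s k) (lift t k)"
| "lift (Disj s t) k = Disj (lift s k) (lift t k)"
| "lift (Imp s t) k = Imp (lift s k) (lift t k)"
| "lift (All \<tau> t) k = All \<tau> (lift t (Suc k))"
| "lift (Ex \<tau> t) k = Ex \<tau> (lift t (Suc k))"

text \<open>\<open>subst t u k\<close> replaces \<open>Var k\<close> by \<open>u\<close> in \<open>t\<close> and closes the gap in the indices above \<open>k\<close>.\<close>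

primrec subst :: "tm \<Rightarrow> tm \<Rightarrow> nat \<Rightarrow> tm" where
  "subst (Var i) u k = (if k < i then Var (i - 1) else if i = k then u else Var i)"
| "subst (App s t) u k = App (subst s u k) (subst t u k)"
| "subst (Lam \<tau> t) u k = Lam \<tau> (subst t (lift u 0) (Suc k))"
| "subst (Eq s t) u k = Eq (subst s u k) (subst t u k)"
| "subst Fls u k = Fls"
| "subst (Conj s t) u k = Conj (subst s u k) (subst t u k)"
| "subst (Disj s t) u k = Disj (subst s u k) (subst t u k)"
| "subst (Imp s t) u k = Imp (subst s u k) (subst t u k)"
| "subst (All \<tau> t) u k = All \<tau> (subst t (lift u 0) (Suc k))"
| "subst (Ex \<tau> t) u k = Ex \<tau> (subst t (lift u 0) (Suc k))"

inductive has_type :: "ty list \<Rightarrow> tm \<Rightarrow> ty \<Rightarrow> bool" where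
  ty_Var: "i < length \<Gamma> \<Longrightarrow> has_type \<Gamma> (Var i) (\<Gamma> ! i)"
| ty_App: "has_type \<Gamma> s (\<sigma> \<rightarrow> \<tau>) \<Longrightarrow> has_type \<Gamma> t \<sigma> \<Longrightarrow> has_type \<Gamma> (App s t) \<tau>"
| ty_Lam: "has_type (\<sigma> # \<Gamma>) t \<tau> \<Longrightarrow> has_type \<Gamma> (Lam \<sigma> t) (\<sigma> \<rightarrow> \<tau>)"
| ty_Eq: "has_type \<Gamma> s \<tau> \<Longrightarrow> has_type \<Gamma> t \<tau> \<Longrightarrow> has_type \<Gamma> (Eq s t) Prop"
| ty_Fls: "has_type \<Gamma> Fls Prop"
| ty_Conj: "has_type \<Gamma> s Prop \<Longrightarrow> has_type \<Gamma> t Prop \<Longrightarrow> has_type \<Gamma> (Conj s t) Prop"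
| ty_Disj: "has_type \<Gamma> s Prop \<Longrightarrow> has_type \<Gamma> t Prop \<Longrightarrow> has_type \<Gamma> (Disj s t) Prop"
| ty_Imp: "has_type \<Gamma> s Prop \<Longrightarrow> has_type \<Gamma> t Prop \<Longrightarrow> has_type \<Gamma> (Imp s t) Prop"
| ty_All: "has_type (\<tau> # \<Gamma>) t Prop \<Longrightarrow> has_type \<Gamma> (All \<tau> t) Prop"
| ty_Ex: "has_type (\<tau> # \<Gamma>) t Prop \<Longrightarrow> has_type \<Gamma> (Ex \<tau> t) Prop"

text \<open>
  \<open>derives \<Gamma> \<Delta> \<phi>\<close>: in the context \<open>\<Gamma>\<close> of typed variables, \<open>\<phi>\<close> follows from the hypotheses \<open>\<Delta>\<close>.
  Natural deduction for intuitionistic logic with equality, \<open>\<beta>\<close>, function extensionality (hence \<open>\<eta>\<close>)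
  and propositional extensionality, but with neither excluded middle nor choice. The context is
  explicit because types may be empty.
\<close>

inductive derives :: "ty list \<Rightarrow> tm list \<Rightarrow> tm \<Rightarrow> bool" where
  hyp: "\<phi> \<in> set \<Delta> \<Longrightarrow> derives \<Gamma> \<Delta> \<phi>"
| flsE: "derives \<Gamma> \<Delta> Fls \<Longrightarrow> has_type \<Gamma> \<phi> Prop \<Longrightarrow> derives \<Gamma> \<Delta> \<phi>"
| conjI: "derives \<Gamma> \<Delta> \<phi> \<Longrightarrow> derives \<Gamma> \<Delta> \<psi> \<Longrightarrow> derives \<Gamma> \<Delta> (Conj \<phi> \<psi>)"
| conjE1: "derives \<Gamma> \<Delta> (Conj \<phi> \<psi>) \<Longrightarrow> derives \<Gamma> \<Delta> \<phi>"
| conjE2: "derives \<Gamma> \<Delta> (Conj \<phi> \<psi>) \<Longrightarrow> derives \<Gamma> \<Delta> \<psi>"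
| disjI1: "derives \<Gamma> \<Delta> \<phi> \<Longrightarrow> has_type \<Gamma> \<psi> Prop \<Longrightarrow> derives \<Gamma> \<Delta> (Disj \<phi> \<psi>)"
| disjI2: "derives \<Gamma> \<Delta> \<psi> \<Longrightarrow> has_type \<Gamma> \<phi> Prop \<Longrightarrow> derives \<Gamma> \<Delta> (Disj \<phi> \<psi>)"
| disjE: "derives \<Gamma> \<Delta> (Disj \<phi> \<psi>) \<Longrightarrow> derives \<Gamma> (\<phi> # \<Delta>) \<chi> \<Longrightarrow> derives \<Gamma> (\<psi> # \<Delta>) \<chi>
    \<Longrightarrow> derives \<Gamma> \<Delta> \<chi>"
| impI: "derives \<Gamma> (\<phi> # \<Delta>) \<psi> \<Longrightarrow> has_type \<Gamma> \<phi> Prop \<Longrightarrow> derives \<Gamma> \<Delta> (Imp \<phi> \<psi>)"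
| impE: "derives \<Gamma> \<Delta> (Imp \<phi> \<psi>) \<Longrightarrow> derives \<Gamma> \<Delta> \<phi> \<Longrightarrow> derives \<Gamma> \<Delta> \<psi>"
| allI: "derives (\<tau> # \<Gamma>) (map (\<lambda>\<psi>. lift \<psi> 0) \<Delta>) \<phi> \<Longrightarrow> derives \<Gamma> \<Delta> (All \<tau> \<phi>)"
| allE: "derives \<Gamma> \<Delta> (All \<tau> \<phi>) \<Longrightarrow> has_type \<Gamma> t \<tau> \<Longrightarrow> derives \<Gamma> \<Delta> (subst \<phi> t 0)"
| exI: "derives \<Gamma> \<Delta> (subst \<phi> t 0) \<Longrightarrow> has_type \<Gamma> t \<tau> \<Longrightarrow> has_type (\<tau> # \<Gamma>) \<phi> Prop
    \<Longrightarrow> derives \<Gamma> \<Delta> (Ex \<tau> \<phi>)"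
| exE: "derives \<Gamma> \<Delta> (Ex \<tau> \<phi>)
    \<Longrightarrow> derives (\<tau> # \<Gamma>) (\<phi> # map (\<lambda>\<psi>. lift \<psi> 0) \<Delta>) (lift \<chi> 0) \<Longrightarrow> derives \<Gamma> \<Delta> \<chi>"
| eqI: "has_type \<Gamma> t \<tau> \<Longrightarrow> derives \<Gamma> \<Delta> (Eq t t)"
| eqE: "derives \<Gamma> \<Delta> (Eq s t) \<Longrightarrow> derives \<Gamma> \<Delta> (subst \<phi> s 0)
    \<Longrightarrow> has_type \<Gamma> s \<tau> \<Longrightarrow> has_type \<Gamma> t \<tau> \<Longrightarrow> has_type (\<tau> # \<Gamma>) \<phi> Prop
    \<Longrightarrow> derives \<Gamma> \<Delta> (subst \<phi> t 0)"
| beta: "has_type (\<sigma> # \<Gamma>) t \<tau> \<Longrightarrow> has_type \<Gamma> u \<sigma>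
    \<Longrightarrow> derives \<Gamma> \<Delta> (Eq (App (Lam \<sigma> t) u) (subst t u 0))"
| fun_ext: "has_type \<Gamma> f (\<sigma> \<rightarrow> \<tau>) \<Longrightarrow> has_type \<Gamma> g (\<sigma> \<rightarrow> \<tau>)
    \<Longrightarrow> derives \<Gamma> \<Delta> (All \<sigma> (Eq (App (lift f 0) (Var 0)) (App (lift g 0) (Var 0))))
    \<Longrightarrow> derives \<Gamma> \<Delta> (Eq f g)"
| prop_ext: "derives \<Gamma> \<Delta> (Imp \<phi> \<psi>) \<Longrightarrow> derives \<Gamma> \<Delta> (Imp \<psi> \<phi>) \<Longrightarrow> derives \<Gamma> \<Delta> (Eq \<phi> \<psi>)"


section \<open>Notation with named variables\<close>

text \<open>
  An expression is a family of terms: its value at \<open>n\<close> is the term to be placed under \<open>n\<close> binders.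
  The variable bound by the binder at depth \<open>n\<close> has, at depth \<open>m > n\<close>, the index \<open>m - Suc n\<close>.
  Variables can thus be written as variables of the metalogic, and parameters of a definition may be
  placed under binders without explicit lifting.
\<close>

type_synonym exp = "nat \<Rightarrow> tm"

definition var :: "nat \<Rightarrow> exp" where
  "var n = (\<lambda>m. Var (m - Suc n))"

definition eApp :: "exp \<Rightarrow> exp \<Rightarrow> exp" (infixl "\<cdot>" 90) where
  "s \<cdot> t = (\<lambda>n. App (s n) (t n))"

definition eEq :: "exp \<Rightarrow> exp \<Rightarrow> exp" (infix "\<^bold>=" 60) where
  "(s \<^bold>= t) = (\<lambda>n. Eq (s n) (t n))"

definition eFls :: exp ("\<^bold>\<bottom>") where
  "\<^bold>\<bottom> = (\<lambda>n. Fls)"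

definition eConj :: "exp \<Rightarrow> exp \<Rightarrow> exp" (infixr "\<^bold>\<and>" 55) where
  "(s \<^bold>\<and> t) = (\<lambda>n. Conj (s n) (t n))"

definition eDisj :: "exp \<Rightarrow> exp \<Rightarrow> exp" (infixr "\<^bold>\<or>" 54) where
  "(s \<^bold>\<or> t) = (\<lambda>n. Disj (s n) (t n))"

definition eImp :: "exp \<Rightarrow> exp \<Rightarrow> exp" (infixr "\<^bold>\<longrightarrow>" 53) where
  "(s \<^bold>\<longrightarrow> t) = (\<lambda>n. Imp (s n) (t n))"

definition eNot :: "exp \<Rightarrow> exp" ("\<^bold>\<not> _" [58] 58) where
  "(\<^bold>\<not> s) = (s \<^bold>\<longrightarrow> \<^bold>\<bottom>)"

definition eLam :: "ty \<Rightarrow> (exp \<Rightarrow> exp) \<Rightarrow> exp" where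
  "eLam \<tau> F = (\<lambda>n. Lam \<tau> (F (var n) (Suc n)))"

definition eAll :: "ty \<Rightarrow> (exp \<Rightarrow> exp) \<Rightarrow> exp" where
  "eAll \<tau> F = (\<lambda>n. All \<tau> (F (var n) (Suc n)))"

definition eEx :: "ty \<Rightarrow> (exp \<Rightarrow> exp) \<Rightarrow> exp" where
  "eEx \<tau> F = (\<lambda>n. Ex \<tau> (F (var n) (Suc n)))"

syntax
  "_eLam" :: "pttrn \<Rightarrow> ty \<Rightarrow> exp \<Rightarrow> exp"  ("(3\<^bold>\<lambda>_\<in>_./ _)" [0, 0, 52] 52)
  "_eAll" :: "pttrn \<Rightarrow> ty \<Rightarrow> exp \<Rightarrow> exp"  ("(3\<^bold>\<forall>_\<in>_./ _)" [0, 0, 52] 52)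
  "_eEx" :: "pttrn \<Rightarrow> ty \<Rightarrow> exp \<Rightarrow> exp"  ("(3\<^bold>\<exists>_\<in>_./ _)" [0, 0, 52] 52)
translations
  "\<^bold>\<lambda>x\<in>\<tau>. t" == "CONST eLam \<tau> (\<lambda>x. t)"
  "\<^bold>\<forall>x\<in>\<tau>. t" == "CONST eAll \<tau> (\<lambda>x. t)"
  "\<^bold>\<exists>x\<in>\<tau>. t" == "CONST eEx \<tau> (\<lambda>x. t)"

text \<open>A sentence holds constructively if it is derivable from no hypotheses.\<close>

definition holds :: "exp \<Rightarrow> bool" ("\<turnstile> _" [51] 50) where
  "(\<turnstile> \<phi>) \<longleftrightarrow> derives [] [] (\<phi> 0)"


section \<open>Directed complete posets and apartness\<close>

definition excluded_middle :: exp where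
  "excluded_middle = (\<^bold>\<forall>P\<in>Prop. P \<^bold>\<or> \<^bold>\<not> P)"

definition weak_excluded_middle :: exp where
  "weak_excluded_middle = (\<^bold>\<forall>P\<in>Prop. \<^bold>\<not> P \<^bold>\<or> \<^bold>\<not> \<^bold>\<not> P)"

text \<open>In the following \<open>le\<close> and \<open>ap\<close> are expressions of type \<open>D \<rightarrow> D \<rightarrow> Prop\<close>.\<close>

definition poset :: "ty \<Rightarrow> exp \<Rightarrow> exp" where
  "poset D le =
    ((\<^bold>\<forall>x\<in>D. le \<cdot> x \<cdot> x)
    \<^bold>\<and> (\<^bold>\<forall>x\<in>D. \<^bold>\<forall>y\<in>D. \<^bold>\<forall>z\<in>D. le \<cdot> x \<cdot> y \<^bold>\<longrightarrow> le \<cdot> y \<cdot> z \<^bold>\<longrightarrow> le \<cdot> x \<cdot> z)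
    \<^bold>\<and> (\<^bold>\<forall>x\<in>D. \<^bold>\<forall>y\<in>D. le \<cdot> x \<cdot> y \<^bold>\<longrightarrow> le \<cdot> y \<cdot> x \<^bold>\<longrightarrow> x \<^bold>= y))"

definition directed :: "ty \<Rightarrow> exp \<Rightarrow> exp \<Rightarrow> exp" where
  "directed D le S =
    ((\<^bold>\<exists>x\<in>D. S \<cdot> x)
    \<^bold>\<and> (\<^bold>\<forall>x\<in>D. \<^bold>\<forall>y\<in>D. S \<cdot> x \<^bold>\<longrightarrow> S \<cdot> y \<^bold>\<longrightarrow> (\<^bold>\<exists>z\<in>D. S \<cdot> z \<^bold>\<and> le \<cdot> x \<cdot> z \<^bold>\<and> le \<cdot> y \<cdot> z)))"

text \<open>
  \<open>is_sup D le S z\<close> renders the equation \<open>z = \<Squnion>S\<close>; by antisymmetry \<open>S\<close> has at most one supremum.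
\<close>

definition is_sup :: "ty \<Rightarrow> exp \<Rightarrow> exp \<Rightarrow> exp \<Rightarrow> exp" where
  "is_sup D le S z =
    ((\<^bold>\<forall>x\<in>D. S \<cdot> x \<^bold>\<longrightarrow> le \<cdot> x \<cdot> z)
    \<^bold>\<and> (\<^bold>\<forall>u\<in>D. (\<^bold>\<forall>x\<in>D. S \<cdot> x \<^bold>\<longrightarrow> le \<cdot> x \<cdot> u) \<^bold>\<longrightarrow> le \<cdot> z \<cdot> u))"

definition dcpo :: "ty \<Rightarrow> exp \<Rightarrow> exp" where
  "dcpo D le =
    (poset D le \<^bold>\<and> (\<^bold>\<forall>S\<in>D \<rightarrow> Prop. directed D le S \<^bold>\<longrightarrow> (\<^bold>\<exists>z\<in>D. is_sup D le S z)))"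

text \<open>The subsets \<open>{a}\<close>, \<open>{z | P}\<close> (inhabited by \<open>z\<close> just when \<open>P\<close> holds) and \<open>A \<union> B\<close>.\<close>

definition singleton :: "ty \<Rightarrow> exp \<Rightarrow> exp" where
  "singleton D a = (\<^bold>\<lambda>w\<in>D. w \<^bold>= a)"

definition singleton_if :: "ty \<Rightarrow> exp \<Rightarrow> exp \<Rightarrow> exp" where
  "singleton_if D z P = (\<^bold>\<lambda>w\<in>D. w \<^bold>= z \<^bold>\<and> P)"

definition set_union :: "ty \<Rightarrow> exp \<Rightarrow> exp \<Rightarrow> exp" where
  "set_union D A B = (\<^bold>\<lambda>w\<in>D. A \<cdot> w \<^bold>\<or> B \<cdot> w)"

definition strictly_below :: "ty \<Rightarrow> exp \<Rightarrow> exp \<Rightarrow> exp \<Rightarrow> exp" where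
  "strictly_below D le x y =
    (le \<cdot> x \<cdot> y
    \<^bold>\<and> (\<^bold>\<forall>z\<in>D. le \<cdot> y \<cdot> z \<^bold>\<longrightarrow>
        (\<^bold>\<forall>P\<in>Prop. is_sup D le (set_union D (singleton D x) (singleton_if D z P)) z \<^bold>\<longrightarrow> P)))"

definition apartness :: "ty \<Rightarrow> exp \<Rightarrow> exp" where
  "apartness D ap =
    ((\<^bold>\<forall>x\<in>D. \<^bold>\<not> ap \<cdot> x \<cdot> x) \<^bold>\<and> (\<^bold>\<forall>x\<in>D. \<^bold>\<forall>y\<in>D. ap \<cdot> x \<cdot> y \<^bold>\<longrightarrow> ap \<cdot> y \<cdot> x))"

definition tight :: "ty \<Rightarrow> exp \<Rightarrow> exp" where
  "tight D ap = (\<^bold>\<forall>x\<in>D. \<^bold>\<forall>y\<in>D. \<^bold>\<not> ap \<cdot> x \<cdot> y \<^bold>\<longrightarrow> x \<^bold>= y)"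

definition cotransitive :: "ty \<Rightarrow> exp \<Rightarrow> exp" where
  "cotransitive D ap =
    (\<^bold>\<forall>x\<in>D. \<^bold>\<forall>y\<in>D. \<^bold>\<forall>z\<in>D. ap \<cdot> x \<cdot> y \<^bold>\<longrightarrow> ap \<cdot> x \<cdot> z \<^bold>\<or> ap \<cdot> y \<cdot> z)"

end

theory Submission
  imports Defs
begin

text \<open>
  Both parts look at the supremum \<open>s\<close> of \<open>{x} \<union> {y | P}\<close>, which is \<open>y\<close> if \<open>P\<close> holds and \<open>x\<close> if \<open>\<not> P\<close>
  holds.

  If \<open>\<sharp>\<close> is tight, then \<open>\<not>\<not> P\<close> excludes \<open>y \<sharp> s\<close>, so \<open>s = y\<close>, and \<open>x\<close> being strictly below \<open>y\<close> yields
  \<open>P\<close>. This is double negation elimination, which gives excluded middle when applied to \<open>P \<or> \<not> P\<close>.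

  If \<open>\<sharp>\<close> is cotransitive, then \<open>x \<sharp> y\<close> gives \<open>x \<sharp> s\<close> or \<open>y \<sharp> s\<close>. The former refutes \<open>\<not> P\<close> and the
  latter refutes \<open>P\<close>.
\<close>

section \<open>Substitution and weakening\<close>

text \<open>The index \<open>i\<close> is general because it grows under every binder. The rewrite
  rule that follows keeps only \<open>i = 0\<close>, the lift that \<open>subst\<close> inserts on
  entering a binder.\<close>

lemma lift_lift: "i \<le> k \<Longrightarrow> lift (lift t i) (Suc k) = lift (lift t k) i"
  by (induction t arbitrary: i k) auto

lemma lift_lift_0 [simp]: "lift (lift t 0) (Suc k) = lift (lift t k) 0"
  by (simp add: lift_lift)

lemma subst_lift [simp]: "subst (lift t k) u k = t"
  by (induction t arbitrary: k u) auto

text \<open>Under a binder the induction hypothesis is needed for \<open>lift u 0\<close> in place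
  of \<open>u\<close>; the reversed \<open>lift_lift_0\<close> brings the two lifts of
  \<open>u\<close> into the order in which it applies.\<close>

lemma subst_lift_Suc: "i \<le> k \<Longrightarrow> subst (lift t i) (lift u i) (Suc k) = lift (subst t u k) i"
  by (induction t arbitrary: i k u) (auto simp flip: lift_lift_0)

lemma subst_lift_Suc_0 [simp]: "subst (lift t 0) (lift u 0) (Suc k) = lift (subst t u k) 0"
  by (simp add: subst_lift_Suc)

text \<open>The new variable enters in the middle of the context, behind those bound inside
  \<open>t\<close>: under a binder the prefix \<open>\<Gamma>1\<close> grows, which lets the
  induction go through.\<close>

lemma has_type_lift_append:
  "has_type (\<Gamma>1 @ \<Gamma>2) t \<tau> \<Longrightarrow> has_type (\<Gamma>1 @ \<sigma> # \<Gamma>2) (lift t (length \<Gamma>1)) \<tau>"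
proof (induction "\<Gamma>1 @ \<Gamma>2" t \<tau> arbitrary: \<Gamma>1 rule: has_type.induct)
  case (ty_Var i)
  show ?case
  proof (cases "i < length \<Gamma>1")
    case True
    then show ?thesis
      using has_type.ty_Var[of i "\<Gamma>1 @ \<sigma> # \<Gamma>2"] by (simp add: nth_append)
  next
    case False
    then show ?thesis
      using ty_Var has_type.ty_Var[of "Suc i" "\<Gamma>1 @ \<sigma> # \<Gamma>2"] by (simp add: nth_append Suc_diff_le)
  qed
next
  case (ty_Lam \<rho> t \<tau>)
  then show ?case using ty_Lam(2)[of "\<rho> # \<Gamma>1"] by (auto intro: has_type.intros)
next
  case (ty_All \<rho> t)
  then show ?case using ty_All(2)[of "\<rho> # \<Gamma>1"] by (auto intro: has_type.intros)
next
  case (ty_Ex \<rho> t)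
  then show ?case using ty_Ex(2)[of "\<rho> # \<Gamma>1"] by (auto intro: has_type.intros)
qed (auto intro: has_type.intros)

lemma has_type_lift: "has_type \<Gamma> t \<tau> \<Longrightarrow> has_type (\<sigma> # \<Gamma>) (lift t 0) \<tau>"
  using has_type_lift_append[of "[]"] by simp

text \<open>Comparing hypotheses as sets gives weakening, exchange and contraction at once. The
  rules treated separately are those whose premises change the list of hypotheses, so that the
  inclusion has to be carried over to the changed lists.\<close>

lemma derives_mono: "derives \<Gamma> \<Delta> \<phi> \<Longrightarrow> set \<Delta> \<subseteq> set \<Delta>' \<Longrightarrow> derives \<Gamma> \<Delta>' \<phi>"
proof (induction arbitrary: \<Delta>' rule: derives.induct)
  case (disjE \<Gamma> \<Delta> \<phi> \<psi> \<chi>)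
  show ?case
    by (rule derives.disjE[OF disjE.IH(1)[OF disjE.prems]]; rule disjE.IH)
      (use disjE.prems in auto)
next
  case (impI \<Gamma> \<phi> \<Delta> \<psi>)
  show ?case
    by (rule derives.impI[OF impI.IH impI.hyps(2)]) (use impI.prems in auto)
next
  case (allI \<tau> \<Gamma> \<Delta> \<phi>)
  show ?case
    by (rule derives.allI, rule allI.IH) (use allI.prems in auto)
next
  case (exE \<Gamma> \<Delta> \<tau> \<phi> \<chi>)
  show ?case
    by (rule derives.exE[OF exE.IH(1)[OF exE.prems]], rule exE.IH) (use exE.prems in auto)
qed (blast intro: derives.intros)+


section \<open>Entailment between expressions\<close>

text \<open>
  Expressions are arbitrary functions on depths. The second conjunct selects those that behave like
  a single term which is weakened as binders are passed.
\<close>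

definition typed :: "ty list \<Rightarrow> exp \<Rightarrow> ty \<Rightarrow> bool" where
  "typed \<Gamma> e \<tau> \<longleftrightarrow> has_type \<Gamma> (e (length \<Gamma>)) \<tau> \<and> (\<forall>m\<ge>length \<Gamma>. e (Suc m) = lift (e m) 0)"

text \<open>
  Typing of the hypotheses is a premise of the entailment, so that rules which move hypotheses under
  a binder need no side condition on \<open>\<Delta>\<close>.
\<close>

definition entails :: "ty list \<Rightarrow> exp list \<Rightarrow> exp \<Rightarrow> bool" ("_ \<triangleright> _ \<tturnstile> _" [51, 51, 51] 50) where
  "(\<Gamma> \<triangleright> \<Delta> \<tturnstile> \<phi>) \<longleftrightarrow> ((\<forall>\<psi>\<in>set \<Delta>. typed \<Gamma> \<psi> Prop) \<longrightarrow>
    derives \<Gamma> (map (\<lambda>\<psi>. \<psi> (length \<Gamma>)) \<Delta>) (\<phi> (length \<Gamma>)))"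

section \<open>Typing of expressions\<close>

lemma typed_has_type: "typed \<Gamma> e \<tau> \<Longrightarrow> has_type \<Gamma> (e (length \<Gamma>)) \<tau>"
  by (simp add: typed_def)

lemma typed_Suc: "typed \<Gamma> e \<tau> \<Longrightarrow> length \<Gamma> \<le> m \<Longrightarrow> e (Suc m) = lift (e m) 0"
  by (simp add: typed_def)

text \<open>An expression needs no explicit lift to enter a longer context: it is evaluated one
  level deeper, and uniformity makes that value the lifted term.\<close>

lemma typed_weaken: "typed \<Gamma> e \<tau> \<Longrightarrow> typed (\<sigma> # \<Gamma>) e \<tau>"
  by (auto simp: typed_def intro: has_type_lift)

lemma var_top [simp]: "var n (Suc n) = Var 0"
  by (simp add: var_def)

text \<open>For \<open>m \<le> n\<close> truncated subtraction makes \<open>var n m\<close> the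
  meaningless \<open>Var 0\<close>, so the recurrence only starts above the binder's own
  depth.\<close>

lemma var_Suc [simp]: "n < m \<Longrightarrow> var n (Suc m) = lift (var n m) 0"
  by (auto simp: var_def)

lemma typed_var: "typed (\<tau> # \<Gamma>) (var (length \<Gamma>)) \<tau>"
  using ty_Var[of 0 "\<tau> # \<Gamma>"] by (simp add: typed_def)

lemma typed_App: "typed \<Gamma> s (\<sigma> \<rightarrow> \<tau>) \<Longrightarrow> typed \<Gamma> t \<sigma> \<Longrightarrow> typed \<Gamma> (s \<cdot> t) \<tau>"
  by (auto simp: typed_def eApp_def intro: has_type.intros)

lemma typed_Eq: "typed \<Gamma> s \<tau> \<Longrightarrow> typed \<Gamma> t \<tau> \<Longrightarrow> typed \<Gamma> (s \<^bold>= t) Prop"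
  by (auto simp: typed_def eEq_def intro: has_type.intros)

lemma typed_Fls: "typed \<Gamma> \<^bold>\<bottom> Prop"
  by (auto simp: typed_def eFls_def intro: has_type.intros)

lemma typed_Conj: "typed \<Gamma> s Prop \<Longrightarrow> typed \<Gamma> t Prop \<Longrightarrow> typed \<Gamma> (s \<^bold>\<and> t) Prop"
  by (auto simp: typed_def eConj_def intro: has_type.intros)

lemma typed_Disj: "typed \<Gamma> s Prop \<Longrightarrow> typed \<Gamma> t Prop \<Longrightarrow> typed \<Gamma> (s \<^bold>\<or> t) Prop"
  by (auto simp: typed_def eDisj_def intro: has_type.intros)

lemma typed_Imp: "typed \<Gamma> s Prop \<Longrightarrow> typed \<Gamma> t Prop \<Longrightarrow> typed \<Gamma> (s \<^bold>\<longrightarrow> t) Prop"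
  by (auto simp: typed_def eImp_def intro: has_type.intros)

lemma typed_Not: "typed \<Gamma> s Prop \<Longrightarrow> typed \<Gamma> (\<^bold>\<not> s) Prop"
  by (simp add: eNot_def typed_Imp typed_Fls)

text \<open>\<open>F\<close> is an arbitrary function of the metalogic, so it has to be assumed that
  moving the abstraction one level deeper lifts its body. The lift starts at \<open>Suc 0\<close> to
  spare the bound variable. For concrete bodies, unfolding the notation proves the
  condition.\<close>

lemma typed_Lam:
  assumes "typed (\<sigma> # \<Gamma>) (F (var (length \<Gamma>))) \<tau>"
    and "\<And>m. length \<Gamma> \<le> m \<Longrightarrow> F (var (Suc m)) (Suc (Suc m)) = lift (F (var m) (Suc m)) (Suc 0)"
  shows "typed \<Gamma> (eLam \<sigma> F) (\<sigma> \<rightarrow> \<tau>)"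
  using assms by (auto simp: typed_def eLam_def intro: has_type.intros)

lemma typed_All:
  assumes "typed (\<tau> # \<Gamma>) (F (var (length \<Gamma>))) Prop"
    and "\<And>m. length \<Gamma> \<le> m \<Longrightarrow> F (var (Suc m)) (Suc (Suc m)) = lift (F (var m) (Suc m)) (Suc 0)"
  shows "typed \<Gamma> (eAll \<tau> F) Prop"
  using assms by (auto simp: typed_def eAll_def intro: has_type.intros)

lemma typed_Ex:
  assumes "typed (\<tau> # \<Gamma>) (F (var (length \<Gamma>))) Prop"
    and "\<And>m. length \<Gamma> \<le> m \<Longrightarrow> F (var (Suc m)) (Suc (Suc m)) = lift (F (var m) (Suc m)) (Suc 0)"
  shows "typed \<Gamma> (eEx \<tau> F) Prop"
  using assms by (auto simp: typed_def eEx_def intro: has_type.intros)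

lemmas typed_intros = typed_var typed_App typed_Eq typed_Fls typed_Conj typed_Disj typed_Imp typed_Not
  typed_Lam typed_All typed_Ex

lemmas exp_defs = eApp_def eEq_def eFls_def eConj_def eDisj_def eImp_def eNot_def
  eLam_def eAll_def eEx_def

section \<open>Natural deduction for expressions\<close>

lemma entails_mono:
  assumes "\<Gamma> \<triangleright> \<Delta> \<tturnstile> \<phi>" "set \<Delta> \<subseteq> set \<Delta>'"
  shows "\<Gamma> \<triangleright> \<Delta>' \<tturnstile> \<phi>"
proof -
  have "set (map (\<lambda>\<psi>. \<psi> (length \<Gamma>)) \<Delta>) \<subseteq> set (map (\<lambda>\<psi>. \<psi> (length \<Gamma>)) \<Delta>')"
    using assms(2) by (simp add: image_mono)
  then show ?thesis
    using assms derives_mono unfolding entails_def by blast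
qed

lemma entails_hyp: "\<phi> \<in> set \<Delta> \<Longrightarrow> \<Gamma> \<triangleright> \<Delta> \<tturnstile> \<phi>"
  by (auto simp: entails_def intro: derives.hyp)

lemma entails_FlsE: "\<Gamma> \<triangleright> \<Delta> \<tturnstile> \<^bold>\<bottom> \<Longrightarrow> typed \<Gamma> \<phi> Prop \<Longrightarrow> \<Gamma> \<triangleright> \<Delta> \<tturnstile> \<phi>"
  by (auto simp: entails_def eFls_def typed_def intro: derives.flsE)

lemma entails_conjI: "\<Gamma> \<triangleright> \<Delta> \<tturnstile> \<phi> \<Longrightarrow> \<Gamma> \<triangleright> \<Delta> \<tturnstile> \<psi> \<Longrightarrow> \<Gamma> \<triangleright> \<Delta> \<tturnstile> \<phi> \<^bold>\<and> \<psi>"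
  by (auto simp: entails_def eConj_def intro: derives.conjI)

lemma entails_conjE1: "\<Gamma> \<triangleright> \<Delta> \<tturnstile> \<phi> \<^bold>\<and> \<psi> \<Longrightarrow> \<Gamma> \<triangleright> \<Delta> \<tturnstile> \<phi>"
  by (auto simp: entails_def eConj_def intro: derives.conjE1)

lemma entails_conjE2: "\<Gamma> \<triangleright> \<Delta> \<tturnstile> \<phi> \<^bold>\<and> \<psi> \<Longrightarrow> \<Gamma> \<triangleright> \<Delta> \<tturnstile> \<psi>"
  by (auto simp: entails_def eConj_def intro: derives.conjE2)

lemma entails_disjI1: "\<Gamma> \<triangleright> \<Delta> \<tturnstile> \<phi> \<Longrightarrow> typed \<Gamma> \<psi> Prop \<Longrightarrow> \<Gamma> \<triangleright> \<Delta> \<tturnstile> \<phi> \<^bold>\<or> \<psi>"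
  by (auto simp: entails_def eDisj_def typed_def intro: derives.disjI1)

lemma entails_disjI2: "\<Gamma> \<triangleright> \<Delta> \<tturnstile> \<psi> \<Longrightarrow> typed \<Gamma> \<phi> Prop \<Longrightarrow> \<Gamma> \<triangleright> \<Delta> \<tturnstile> \<phi> \<^bold>\<or> \<psi>"
  by (auto simp: entails_def eDisj_def typed_def intro: derives.disjI2)

lemma entails_disjE:
  assumes "\<Gamma> \<triangleright> \<Delta> \<tturnstile> \<phi> \<^bold>\<or> \<psi>" "\<Gamma> \<triangleright> \<phi> # \<Delta> \<tturnstile> \<chi>" "\<Gamma> \<triangleright> \<psi> # \<Delta> \<tturnstile> \<chi>"
    and "typed \<Gamma> \<phi> Prop" "typed \<Gamma> \<psi> Prop"
  shows "\<Gamma> \<triangleright> \<Delta> \<tturnstile> \<chi>"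
  using assms by (auto simp: entails_def eDisj_def intro: derives.disjE)

lemma entails_impI: "\<Gamma> \<triangleright> \<phi> # \<Delta> \<tturnstile> \<psi> \<Longrightarrow> typed \<Gamma> \<phi> Prop \<Longrightarrow> \<Gamma> \<triangleright> \<Delta> \<tturnstile> \<phi> \<^bold>\<longrightarrow> \<psi>"
  by (auto simp: entails_def eImp_def typed_has_type intro: derives.impI)

lemma entails_impE: "\<Gamma> \<triangleright> \<Delta> \<tturnstile> \<phi> \<^bold>\<longrightarrow> \<psi> \<Longrightarrow> \<Gamma> \<triangleright> \<Delta> \<tturnstile> \<phi> \<Longrightarrow> \<Gamma> \<triangleright> \<Delta> \<tturnstile> \<psi>"
  by (auto simp: entails_def eImp_def intro: derives.impE)

lemma entails_cut: "\<Gamma> \<triangleright> \<Delta> \<tturnstile> \<phi> \<Longrightarrow> \<Gamma> \<triangleright> \<phi> # \<Delta> \<tturnstile> \<psi> \<Longrightarrow> typed \<Gamma> \<phi> Prop \<Longrightarrow> \<Gamma> \<triangleright> \<Delta> \<tturnstile> \<psi>"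
  by (blast intro: entails_impI entails_impE)

lemma entails_notI: "\<Gamma> \<triangleright> \<phi> # \<Delta> \<tturnstile> \<^bold>\<bottom> \<Longrightarrow> typed \<Gamma> \<phi> Prop \<Longrightarrow> \<Gamma> \<triangleright> \<Delta> \<tturnstile> \<^bold>\<not> \<phi>"
  by (simp add: eNot_def entails_impI)

lemma entails_notE: "\<Gamma> \<triangleright> \<Delta> \<tturnstile> \<^bold>\<not> \<phi> \<Longrightarrow> \<Gamma> \<triangleright> \<Delta> \<tturnstile> \<phi> \<Longrightarrow> \<Gamma> \<triangleright> \<Delta> \<tturnstile> \<^bold>\<bottom>"
  by (auto simp: eNot_def intro: entails_impE)

lemma entails_conjL:
  assumes "\<Gamma> \<triangleright> \<phi> # \<psi> # \<Delta> \<tturnstile> \<chi>" "typed \<Gamma> \<phi> Prop" "typed \<Gamma> \<psi> Prop"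
  shows "\<Gamma> \<triangleright> (\<phi> \<^bold>\<and> \<psi>) # \<Delta> \<tturnstile> \<chi>"
proof (rule entails_cut, rule entails_conjE2, rule entails_hyp)
  show "\<Gamma> \<triangleright> \<psi> # (\<phi> \<^bold>\<and> \<psi>) # \<Delta> \<tturnstile> \<chi>"
  proof (rule entails_cut, rule entails_conjE1, rule entails_hyp)
    show "\<Gamma> \<triangleright> \<phi> # \<psi> # (\<phi> \<^bold>\<and> \<psi>) # \<Delta> \<tturnstile> \<chi>"
      by (rule entails_mono[OF assms(1)]) auto
  qed (rule list.set_intros assms)+
qed (rule list.set_intros assms)+

text \<open>This is what the typing premise of \<open>entails\<close> pays for: evaluating uniform
  hypotheses one level deeper is the lift that \<open>allI\<close> and \<open>exE\<close> of the
  calculus perform.\<close>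

lemma map_hyps_Suc:
  "\<forall>\<psi>\<in>set \<Delta>. typed \<Gamma> \<psi> Prop \<Longrightarrow>
    map (\<lambda>\<psi>. \<psi> (Suc (length \<Gamma>))) \<Delta> = map (\<lambda>\<psi>. lift \<psi> 0) (map (\<lambda>\<psi>. \<psi> (length \<Gamma>)) \<Delta>)"
  by (auto simp: typed_Suc)

text \<open>No freshness condition is needed: one level deeper the typed hypotheses become lifted
  terms, in which the new variable \<open>Var 0\<close> does not occur.\<close>

lemma entails_allI: "\<tau> # \<Gamma> \<triangleright> \<Delta> \<tturnstile> F (var (length \<Gamma>)) \<Longrightarrow> \<Gamma> \<triangleright> \<Delta> \<tturnstile> eAll \<tau> F"
  unfolding entails_def
  by (auto simp: eAll_def typed_weaken map_hyps_Suc simp del: map_map intro!: derives.allI)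

text \<open>Instantiation is application of \<open>F\<close> in the metalogic but substitution in
  the calculus. The last premise says that both agree; for a concrete \<open>F\<close> it is a
  computation with \<open>subst\<close>.\<close>

lemma entails_allE:
  assumes "\<Gamma> \<triangleright> \<Delta> \<tturnstile> eAll \<tau> F" "typed \<Gamma> t \<tau>"
    and "subst (F (var (length \<Gamma>)) (Suc (length \<Gamma>))) (t (length \<Gamma>)) 0 = F t (length \<Gamma>)"
  shows "\<Gamma> \<triangleright> \<Delta> \<tturnstile> F t"
  using assms derives.allE[of \<Gamma> _ \<tau> "F (var (length \<Gamma>)) (Suc (length \<Gamma>))" "t (length \<Gamma>)"]
  by (auto simp: entails_def eAll_def typed_def)

text \<open>After the first instantiation the inner variable is bound at depth
  \<open>length \<Gamma>\<close> instead of \<open>Suc (length \<Gamma>)\<close>. The term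
  \<open>s\<close> is substituted under the remaining quantifier, hence its lift and the index
  \<open>Suc 0\<close>.\<close>

lemma entails_allE2:
  assumes "\<Gamma> \<triangleright> \<Delta> \<tturnstile> (\<^bold>\<forall>x\<in>\<sigma>. \<^bold>\<forall>y\<in>\<tau>. F x y)" and "typed \<Gamma> s \<sigma>" "typed \<Gamma> t \<tau>"
    and "subst (F (var (length \<Gamma>)) (var (Suc (length \<Gamma>))) (Suc (Suc (length \<Gamma>))))
      (lift (s (length \<Gamma>)) 0) (Suc 0) = F s (var (length \<Gamma>)) (Suc (length \<Gamma>))"
    and "subst (F s (var (length \<Gamma>)) (Suc (length \<Gamma>))) (t (length \<Gamma>)) 0 = F s t (length \<Gamma>)"
  shows "\<Gamma> \<triangleright> \<Delta> \<tturnstile> F s t"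
  by (rule entails_allE[OF entails_allE[OF assms(1,2)] assms(3,5)]) (simp add: eAll_def assms(4))

lemma entails_exI:
  assumes "\<Gamma> \<triangleright> \<Delta> \<tturnstile> F t" "typed \<Gamma> t \<tau>" "typed (\<tau> # \<Gamma>) (F (var (length \<Gamma>))) Prop"
    and "subst (F (var (length \<Gamma>)) (Suc (length \<Gamma>))) (t (length \<Gamma>)) 0 = F t (length \<Gamma>)"
  shows "\<Gamma> \<triangleright> \<Delta> \<tturnstile> eEx \<tau> F"
  using assms derives.exI[of \<Gamma> _ "F (var (length \<Gamma>)) (Suc (length \<Gamma>))" "t (length \<Gamma>)" \<tau>]
  by (auto simp: entails_def eEx_def typed_def)

text \<open>Typing \<open>\<chi>\<close> in \<open>\<Gamma>\<close>, without the witness, expresses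
  the eigenvariable condition: one level deeper \<open>\<chi>\<close> is its own lift.\<close>

lemma entails_exE:
  assumes "\<Gamma> \<triangleright> \<Delta> \<tturnstile> eEx \<tau> F" "\<tau> # \<Gamma> \<triangleright> F (var (length \<Gamma>)) # \<Delta> \<tturnstile> \<chi>"
    and "typed (\<tau> # \<Gamma>) (F (var (length \<Gamma>))) Prop" "typed \<Gamma> \<chi> Prop"
  shows "\<Gamma> \<triangleright> \<Delta> \<tturnstile> \<chi>"
  unfolding entails_def
proof
  assume *: "\<forall>\<psi>\<in>set \<Delta>. typed \<Gamma> \<psi> Prop"
  then have "derives (\<tau> # \<Gamma>) (F (var (length \<Gamma>)) (Suc (length \<Gamma>)) #
      map (\<lambda>\<psi>. lift \<psi> 0) (map (\<lambda>\<psi>. \<psi> (length \<Gamma>)) \<Delta>)) (lift (\<chi> (length \<Gamma>)) 0)"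
    using assms(2-4) map_hyps_Suc[OF *] typed_Suc[OF assms(4), of "length \<Gamma>"]
    by (simp add: entails_def typed_weaken)
  moreover have "derives \<Gamma> (map (\<lambda>\<psi>. \<psi> (length \<Gamma>)) \<Delta>)
      (Ex \<tau> (F (var (length \<Gamma>)) (Suc (length \<Gamma>))))"
    using assms(1) * by (simp add: entails_def eEx_def)
  ultimately show "derives \<Gamma> (map (\<lambda>\<psi>. \<psi> (length \<Gamma>)) \<Delta>) (\<chi> (length \<Gamma>))"
    using derives.exE by blast
qed

lemma entails_exL:
  assumes "\<tau> # \<Gamma> \<triangleright> F (var (length \<Gamma>)) # \<Delta> \<tturnstile> \<chi>"
    and "typed (\<tau> # \<Gamma>) (F (var (length \<Gamma>))) Prop" "typed \<Gamma> \<chi> Prop"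
  shows "\<Gamma> \<triangleright> eEx \<tau> F # \<Delta> \<tturnstile> \<chi>"
  by (rule entails_exE[where F = F, OF entails_hyp entails_mono[OF assms(1)] assms(2,3)]) auto

section \<open>Equality and beta conversion\<close>

lemma entails_eqI: "typed \<Gamma> t \<tau> \<Longrightarrow> \<Gamma> \<triangleright> \<Delta> \<tturnstile> t \<^bold>= t"
  by (auto simp: entails_def eEq_def typed_def intro: derives.eqI)

lemma entails_eqE:
  assumes "\<Gamma> \<triangleright> \<Delta> \<tturnstile> s \<^bold>= t" "\<Gamma> \<triangleright> \<Delta> \<tturnstile> F s"
    and "typed \<Gamma> s \<tau>" "typed \<Gamma> t \<tau>" "typed (\<tau> # \<Gamma>) (F (var (length \<Gamma>))) Prop"
    and "subst (F (var (length \<Gamma>)) (Suc (length \<Gamma>))) (s (length \<Gamma>)) 0 = F s (length \<Gamma>)"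
    and "subst (F (var (length \<Gamma>)) (Suc (length \<Gamma>))) (t (length \<Gamma>)) 0 = F t (length \<Gamma>)"
  shows "\<Gamma> \<triangleright> \<Delta> \<tturnstile> F t"
  using assms derives.eqE[of \<Gamma> _ "s (length \<Gamma>)" "t (length \<Gamma>)" "F (var (length \<Gamma>)) (Suc (length \<Gamma>))" \<tau>]
  by (auto simp: entails_def eEq_def typed_def)

text \<open>Transport of \<open>s = s\<close> along the equation, in the left-hand place
  only.\<close>

lemma entails_eq_sym:
  assumes "\<Gamma> \<triangleright> \<Delta> \<tturnstile> s \<^bold>= t" and st: "typed \<Gamma> s \<tau>" "typed \<Gamma> t \<tau>"
  shows "\<Gamma> \<triangleright> \<Delta> \<tturnstile> t \<^bold>= s"
  by (rule entails_eqE[where F = "\<lambda>w. w \<^bold>= s", OF assms(1) entails_eqI st])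
    (rule typed_intros st typed_weaken | simp add: exp_defs st[THEN typed_Suc])+

text \<open>Subsets are terms built with \<open>Lam\<close>, so membership reduces to its defining
  condition only through a derivable equation. This one serves the three set operations.\<close>

lemma entails_beta_eq:
  assumes "typed (\<sigma> # \<Gamma>) (F (var (length \<Gamma>))) \<tau>" "typed \<Gamma> t \<sigma>"
    and "subst (F (var (length \<Gamma>)) (Suc (length \<Gamma>))) (t (length \<Gamma>)) 0 = F t (length \<Gamma>)"
  shows "\<Gamma> \<triangleright> \<Delta> \<tturnstile> eLam \<sigma> F \<cdot> t \<^bold>= F t"
  using assms derives.beta[of \<sigma> \<Gamma> "F (var (length \<Gamma>)) (Suc (length \<Gamma>))" \<tau> "t (length \<Gamma>)"]
  by (auto simp: entails_def exp_defs typed_def)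

text \<open>Propositions are terms, so an equation between them is used by transport along the
  identity predicate.\<close>

lemma entails_eq_mp:
  assumes "\<Gamma> \<triangleright> \<Delta> \<tturnstile> \<phi> \<^bold>= \<psi>" "\<Gamma> \<triangleright> \<Delta> \<tturnstile> \<phi>" "typed \<Gamma> \<phi> Prop" "typed \<Gamma> \<psi> Prop"
  shows "\<Gamma> \<triangleright> \<Delta> \<tturnstile> \<psi>"
  by (rule entails_eqE[where F = "\<lambda>w. w", OF assms typed_var]) simp_all

text \<open>Meant for backward use: it replaces \<open>s\<close> by \<open>t\<close> in a goal, so
  the equation is reversed before the transport.\<close>

lemma entails_eq_left:
  assumes "\<Gamma> \<triangleright> \<Delta> \<tturnstile> s \<^bold>= t" "\<Gamma> \<triangleright> \<Delta> \<tturnstile> r \<cdot> t \<cdot> u"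
    and ty: "typed \<Gamma> s \<sigma>" "typed \<Gamma> t \<sigma>" "typed \<Gamma> r (\<sigma> \<rightarrow> \<tau> \<rightarrow> Prop)" "typed \<Gamma> u \<tau>"
  shows "\<Gamma> \<triangleright> \<Delta> \<tturnstile> r \<cdot> s \<cdot> u"
  by (rule entails_eqE[where F = "\<lambda>w. r \<cdot> w \<cdot> u", OF entails_eq_sym[OF assms(1) ty(1,2)] assms(2)])
    (rule typed_intros ty typed_weaken | simp add: exp_defs ty[THEN typed_Suc])+

lemma entails_eq_right:
  assumes "\<Gamma> \<triangleright> \<Delta> \<tturnstile> s \<^bold>= t" "\<Gamma> \<triangleright> \<Delta> \<tturnstile> r \<cdot> u \<cdot> t"
    and ty: "typed \<Gamma> s \<tau>" "typed \<Gamma> t \<tau>" "typed \<Gamma> r (\<sigma> \<rightarrow> \<tau> \<rightarrow> Prop)" "typed \<Gamma> u \<sigma>"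
  shows "\<Gamma> \<triangleright> \<Delta> \<tturnstile> r \<cdot> u \<cdot> s"
  by (rule entails_eqE[where F = "\<lambda>w. r \<cdot> u \<cdot> w", OF entails_eq_sym[OF assms(1) ty(1,2)] assms(2)])
    (rule typed_intros ty typed_weaken | simp add: exp_defs ty[THEN typed_Suc])+


section \<open>Posets, suprema and apartness\<close>

lemma typed_poset:
  assumes ty: "typed \<Gamma> le (D \<rightarrow> D \<rightarrow> Prop)"
  shows "typed \<Gamma> (poset D le) Prop"
  unfolding poset_def
  by (rule typed_intros ty typed_weaken | simp add: exp_defs ty[THEN typed_Suc])+

lemma typed_directed:
  assumes ty: "typed \<Gamma> le (D \<rightarrow> D \<rightarrow> Prop)" "typed \<Gamma> S (D \<rightarrow> Prop)"
  shows "typed \<Gamma> (directed D le S) Prop"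
  unfolding directed_def
  by (rule typed_intros ty typed_weaken | simp add: exp_defs ty[THEN typed_Suc])+

lemma typed_is_sup:
  assumes ty: "typed \<Gamma> le (D \<rightarrow> D \<rightarrow> Prop)" "typed \<Gamma> S (D \<rightarrow> Prop)" "typed \<Gamma> z D"
  shows "typed \<Gamma> (is_sup D le S z) Prop"
  unfolding is_sup_def
  by (rule typed_intros ty typed_weaken | simp add: exp_defs ty[THEN typed_Suc])+

lemma typed_dcpo:
  assumes ty: "typed \<Gamma> le (D \<rightarrow> D \<rightarrow> Prop)"
  shows "typed \<Gamma> (dcpo D le) Prop"
  unfolding dcpo_def
  \<comment> \<open>The typing lemmas do not supply the uniformity conditions of the quantifiers;
    for these the nested definitions are unfolded.\<close>
  by (rule typed_intros typed_poset typed_directed typed_is_sup ty typed_weaken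
      | simp add: exp_defs directed_def is_sup_def ty[THEN typed_Suc])+

lemma typed_singleton:
  assumes ty: "typed \<Gamma> a D"
  shows "typed \<Gamma> (singleton D a) (D \<rightarrow> Prop)"
  unfolding singleton_def
  by (rule typed_intros ty typed_weaken | simp add: exp_defs ty[THEN typed_Suc])+

lemma typed_singleton_if:
  assumes ty: "typed \<Gamma> z D" "typed \<Gamma> P Prop"
  shows "typed \<Gamma> (singleton_if D z P) (D \<rightarrow> Prop)"
  unfolding singleton_if_def
  by (rule typed_intros ty typed_weaken | simp add: exp_defs ty[THEN typed_Suc])+

lemma typed_set_union:
  assumes ty: "typed \<Gamma> A (D \<rightarrow> Prop)" "typed \<Gamma> B (D \<rightarrow> Prop)"
  shows "typed \<Gamma> (set_union D A B) (D \<rightarrow> Prop)"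
  unfolding set_union_def
  by (rule typed_intros ty typed_weaken | simp add: exp_defs ty[THEN typed_Suc])+

lemmas typed_set_intros = typed_set_union typed_singleton typed_singleton_if

lemma typed_strictly_below:
  assumes ty: "typed \<Gamma> le (D \<rightarrow> D \<rightarrow> Prop)" "typed \<Gamma> x D" "typed \<Gamma> y D"
  shows "typed \<Gamma> (strictly_below D le x y) Prop"
  unfolding strictly_below_def
  by (rule typed_intros typed_is_sup typed_set_intros ty typed_weaken
      | simp add: exp_defs is_sup_def set_union_def singleton_def singleton_if_def
          ty[THEN typed_Suc])+

lemma typed_apartness:
  assumes ty: "typed \<Gamma> ap (D \<rightarrow> D \<rightarrow> Prop)"
  shows "typed \<Gamma> (apartness D ap) Prop"
  unfolding apartness_def
  by (rule typed_intros ty typed_weaken | simp add: exp_defs ty[THEN typed_Suc])+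

lemma typed_tight:
  assumes ty: "typed \<Gamma> ap (D \<rightarrow> D \<rightarrow> Prop)"
  shows "typed \<Gamma> (tight D ap) Prop"
  unfolding tight_def
  by (rule typed_intros ty typed_weaken | simp add: exp_defs ty[THEN typed_Suc])+

lemma typed_cotransitive:
  assumes ty: "typed \<Gamma> ap (D \<rightarrow> D \<rightarrow> Prop)"
  shows "typed \<Gamma> (cotransitive D ap) Prop"
  unfolding cotransitive_def
  by (rule typed_intros ty typed_weaken | simp add: exp_defs ty[THEN typed_Suc])+

lemma typed_excluded_middle: "typed \<Gamma> excluded_middle Prop"
  unfolding excluded_middle_def by (rule typed_intros | simp add: exp_defs)+

lemma typed_weak_excluded_middle: "typed \<Gamma> weak_excluded_middle Prop"
  unfolding weak_excluded_middle_def by (rule typed_intros | simp add: exp_defs)+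

section \<open>Use of the order and apartness axioms\<close>

lemma poset_refl:
  assumes "\<Gamma> \<triangleright> \<Delta> \<tturnstile> poset D le" and ty: "typed \<Gamma> le (D \<rightarrow> D \<rightarrow> Prop)" "typed \<Gamma> x D"
  shows "\<Gamma> \<triangleright> \<Delta> \<tturnstile> le \<cdot> x \<cdot> x"
  by (rule entails_allE[OF entails_conjE1[OF assms(1)[unfolded poset_def]] ty(2)])
    (simp add: exp_defs ty[THEN typed_Suc])

lemma poset_antisym:
  assumes "\<Gamma> \<triangleright> \<Delta> \<tturnstile> poset D le" "\<Gamma> \<triangleright> \<Delta> \<tturnstile> le \<cdot> x \<cdot> y" "\<Gamma> \<triangleright> \<Delta> \<tturnstile> le \<cdot> y \<cdot> x"
    and ty: "typed \<Gamma> le (D \<rightarrow> D \<rightarrow> Prop)" "typed \<Gamma> x D" "typed \<Gamma> y D"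
  shows "\<Gamma> \<triangleright> \<Delta> \<tturnstile> x \<^bold>= y"
proof -
  have "\<Gamma> \<triangleright> \<Delta> \<tturnstile> le \<cdot> x \<cdot> y \<^bold>\<longrightarrow> le \<cdot> y \<cdot> x \<^bold>\<longrightarrow> x \<^bold>= y"
    by (rule entails_allE2[OF entails_conjE2[OF entails_conjE2[OF assms(1)[unfolded poset_def]]] ty(2,3)])
      (simp_all add: exp_defs ty[THEN typed_Suc])
  from entails_impE[OF entails_impE[OF this assms(2)] assms(3)] show ?thesis .
qed

lemma is_sup_upper:
  assumes "\<Gamma> \<triangleright> \<Delta> \<tturnstile> is_sup D le S z" "\<Gamma> \<triangleright> \<Delta> \<tturnstile> S \<cdot> w"
    and ty: "typed \<Gamma> le (D \<rightarrow> D \<rightarrow> Prop)" "typed \<Gamma> S (D \<rightarrow> Prop)" "typed \<Gamma> z D" "typed \<Gamma> w D"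
  shows "\<Gamma> \<triangleright> \<Delta> \<tturnstile> le \<cdot> w \<cdot> z"
proof -
  have "\<Gamma> \<triangleright> \<Delta> \<tturnstile> S \<cdot> w \<^bold>\<longrightarrow> le \<cdot> w \<cdot> z"
    by (rule entails_allE[OF entails_conjE1[OF assms(1)[unfolded is_sup_def]] ty(4)])
      (simp add: exp_defs ty[THEN typed_Suc])
  from entails_impE[OF this assms(2)] show ?thesis .
qed

text \<open>The upper bound condition is checked on a generic element of \<open>S\<close>: a new
  variable, under the hypothesis that it belongs to \<open>S\<close>.\<close>

lemma is_sup_least:
  assumes "\<Gamma> \<triangleright> \<Delta> \<tturnstile> is_sup D le S z"
    and "D # \<Gamma> \<triangleright> S \<cdot> var (length \<Gamma>) # \<Delta> \<tturnstile> le \<cdot> var (length \<Gamma>) \<cdot> u"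
    and ty: "typed \<Gamma> le (D \<rightarrow> D \<rightarrow> Prop)" "typed \<Gamma> S (D \<rightarrow> Prop)" "typed \<Gamma> z D" "typed \<Gamma> u D"
  shows "\<Gamma> \<triangleright> \<Delta> \<tturnstile> le \<cdot> z \<cdot> u"
proof -
  have "\<Gamma> \<triangleright> \<Delta> \<tturnstile> (\<^bold>\<forall>x\<in>D. S \<cdot> x \<^bold>\<longrightarrow> le \<cdot> x \<cdot> u) \<^bold>\<longrightarrow> le \<cdot> z \<cdot> u"
    by (rule entails_allE[OF entails_conjE2[OF assms(1)[unfolded is_sup_def]] ty(4)])
      (simp add: exp_defs ty[THEN typed_Suc])
  moreover have "\<Gamma> \<triangleright> \<Delta> \<tturnstile> (\<^bold>\<forall>x\<in>D. S \<cdot> x \<^bold>\<longrightarrow> le \<cdot> x \<cdot> u)"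
    by (rule entails_allI, rule entails_impI[OF assms(2)]) (rule typed_intros ty typed_weaken)+
  ultimately show ?thesis by (rule entails_impE)
qed

lemma is_sup_eq:
  assumes "\<Gamma> \<triangleright> \<Delta> \<tturnstile> s \<^bold>= t" "\<Gamma> \<triangleright> \<Delta> \<tturnstile> is_sup D le S s"
    and ty: "typed \<Gamma> le (D \<rightarrow> D \<rightarrow> Prop)" "typed \<Gamma> S (D \<rightarrow> Prop)" "typed \<Gamma> s D" "typed \<Gamma> t D"
  shows "\<Gamma> \<triangleright> \<Delta> \<tturnstile> is_sup D le S t"
  by (rule entails_eqE[where F = "is_sup D le S", OF assms(1,2) ty(3,4)])
    (rule typed_is_sup typed_var typed_weaken ty | simp add: exp_defs is_sup_def ty[THEN typed_Suc])+

lemma apartness_irrefl: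
  assumes "\<Gamma> \<triangleright> \<Delta> \<tturnstile> apartness D ap" "\<Gamma> \<triangleright> \<Delta> \<tturnstile> ap \<cdot> x \<cdot> x"
    and ty: "typed \<Gamma> ap (D \<rightarrow> D \<rightarrow> Prop)" "typed \<Gamma> x D"
  shows "\<Gamma> \<triangleright> \<Delta> \<tturnstile> \<^bold>\<bottom>"
proof -
  have "\<Gamma> \<triangleright> \<Delta> \<tturnstile> \<^bold>\<not> ap \<cdot> x \<cdot> x"
    by (rule entails_allE[OF entails_conjE1[OF assms(1)[unfolded apartness_def]] ty(2)])
      (simp add: exp_defs ty[THEN typed_Suc])
  from entails_notE[OF this assms(2)] show ?thesis .
qed

lemma tight_eq:
  assumes "\<Gamma> \<triangleright> \<Delta> \<tturnstile> tight D ap" "\<Gamma> \<triangleright> \<Delta> \<tturnstile> \<^bold>\<not> ap \<cdot> x \<cdot> y"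
    and ty: "typed \<Gamma> ap (D \<rightarrow> D \<rightarrow> Prop)" "typed \<Gamma> x D" "typed \<Gamma> y D"
  shows "\<Gamma> \<triangleright> \<Delta> \<tturnstile> x \<^bold>= y"
proof -
  have "\<Gamma> \<triangleright> \<Delta> \<tturnstile> \<^bold>\<not> ap \<cdot> x \<cdot> y \<^bold>\<longrightarrow> x \<^bold>= y"
    by (rule entails_allE2[OF assms(1)[unfolded tight_def] ty(2,3)])
      (simp_all add: exp_defs ty[THEN typed_Suc])
  from entails_impE[OF this assms(2)] show ?thesis .
qed

lemma cotransitive_cases:
  assumes "\<Gamma> \<triangleright> \<Delta> \<tturnstile> cotransitive D ap" "\<Gamma> \<triangleright> \<Delta> \<tturnstile> ap \<cdot> x \<cdot> y"
    and ty: "typed \<Gamma> ap (D \<rightarrow> D \<rightarrow> Prop)" "typed \<Gamma> x D" "typed \<Gamma> y D" "typed \<Gamma> z D"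
  shows "\<Gamma> \<triangleright> \<Delta> \<tturnstile> ap \<cdot> x \<cdot> z \<^bold>\<or> ap \<cdot> y \<cdot> z"
proof -
  have "\<Gamma> \<triangleright> \<Delta> \<tturnstile> (\<^bold>\<forall>z\<in>D. ap \<cdot> x \<cdot> y \<^bold>\<longrightarrow> ap \<cdot> x \<cdot> z \<^bold>\<or> ap \<cdot> y \<cdot> z)"
    by (rule entails_allE2[OF assms(1)[unfolded cotransitive_def] ty(2,3)])
      (simp_all add: exp_defs ty[THEN typed_Suc])
  then have "\<Gamma> \<triangleright> \<Delta> \<tturnstile> ap \<cdot> x \<cdot> y \<^bold>\<longrightarrow> ap \<cdot> x \<cdot> z \<^bold>\<or> ap \<cdot> y \<cdot> z"
    by (rule entails_allE[OF _ ty(4)]) (simp add: exp_defs ty[THEN typed_Suc])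
  from entails_impE[OF this assms(2)] show ?thesis .
qed


section \<open>The subset \<open>{x} \<union> {z | P}\<close>\<close>

text \<open>Only an abbreviation, so that it coincides with the set written out in
  \<open>strictly_below_def\<close>.\<close>

abbreviation partial_pair :: "ty \<Rightarrow> exp \<Rightarrow> exp \<Rightarrow> exp \<Rightarrow> exp" where
  "partial_pair D x z P \<equiv> set_union D (singleton D x) (singleton_if D z P)"

lemma strictly_below_le:
  "\<Gamma> \<triangleright> \<Delta> \<tturnstile> strictly_below D le x y \<Longrightarrow> \<Gamma> \<triangleright> \<Delta> \<tturnstile> le \<cdot> x \<cdot> y"
  unfolding strictly_below_def by (rule entails_conjE1)

text \<open>The source of classical logic in the first part: a fact about suprema is turned into the
  truth of an arbitrary \<open>P\<close>.\<close>

lemma strictly_below_sup: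
  assumes "\<Gamma> \<triangleright> \<Delta> \<tturnstile> strictly_below D le x y" "\<Gamma> \<triangleright> \<Delta> \<tturnstile> le \<cdot> y \<cdot> z"
    and "\<Gamma> \<triangleright> \<Delta> \<tturnstile> is_sup D le (partial_pair D x z P) z"
    and ty: "typed \<Gamma> le (D \<rightarrow> D \<rightarrow> Prop)" "typed \<Gamma> x D" "typed \<Gamma> y D" "typed \<Gamma> z D" "typed \<Gamma> P Prop"
  shows "\<Gamma> \<triangleright> \<Delta> \<tturnstile> P"
proof -
  note defs = exp_defs is_sup_def set_union_def singleton_def singleton_if_def
  have "\<Gamma> \<triangleright> \<Delta> \<tturnstile> le \<cdot> y \<cdot> z \<^bold>\<longrightarrow> (\<^bold>\<forall>P\<in>Prop. is_sup D le (partial_pair D x z P) z \<^bold>\<longrightarrow> P)"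
    by (rule entails_allE[OF entails_conjE2[OF assms(1)[unfolded strictly_below_def]] ty(4)])
      (simp add: defs ty[THEN typed_Suc])
  then have "\<Gamma> \<triangleright> \<Delta> \<tturnstile> (\<^bold>\<forall>P\<in>Prop. is_sup D le (partial_pair D x z P) z \<^bold>\<longrightarrow> P)"
    using assms(2) by (rule entails_impE)
  then have "\<Gamma> \<triangleright> \<Delta> \<tturnstile> is_sup D le (partial_pair D x z P) z \<^bold>\<longrightarrow> P"
    by (rule entails_allE[OF _ ty(5)]) (simp add: defs ty[THEN typed_Suc])
  from entails_impE[OF this assms(3)] show ?thesis .
qed

section \<open>Membership in the set\<close>

lemma set_union_eq:
  assumes ty: "typed \<Gamma> A (D \<rightarrow> Prop)" "typed \<Gamma> B (D \<rightarrow> Prop)" "typed \<Gamma> w D"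
  shows "\<Gamma> \<triangleright> \<Delta> \<tturnstile> set_union D A B \<cdot> w \<^bold>= (A \<cdot> w \<^bold>\<or> B \<cdot> w)"
  unfolding set_union_def
  by (rule entails_beta_eq[OF _ ty(3)])
    (rule typed_intros ty typed_weaken | simp add: exp_defs ty[THEN typed_Suc])+

lemma singleton_eq:
  assumes ty: "typed \<Gamma> a D" "typed \<Gamma> w D"
  shows "\<Gamma> \<triangleright> \<Delta> \<tturnstile> singleton D a \<cdot> w \<^bold>= (w \<^bold>= a)"
  unfolding singleton_def
  by (rule entails_beta_eq[OF _ ty(2)])
    (rule typed_intros ty typed_weaken | simp add: exp_defs ty[THEN typed_Suc])+

lemma singleton_if_eq:
  assumes ty: "typed \<Gamma> z D" "typed \<Gamma> P Prop" "typed \<Gamma> w D"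
  shows "\<Gamma> \<triangleright> \<Delta> \<tturnstile> singleton_if D z P \<cdot> w \<^bold>= (w \<^bold>= z \<^bold>\<and> P)"
  unfolding singleton_if_def
  by (rule entails_beta_eq[OF _ ty(3)])
    (rule typed_intros ty typed_weaken | simp add: exp_defs ty[THEN typed_Suc])+

lemma typed_partial_pair:
  "typed \<Gamma> x D \<Longrightarrow> typed \<Gamma> z D \<Longrightarrow> typed \<Gamma> P Prop \<Longrightarrow> typed \<Gamma> (partial_pair D x z P) (D \<rightarrow> Prop)"
  by (intro typed_set_intros)

lemma partial_pair_left:
  assumes ty: "typed \<Gamma> x D" "typed \<Gamma> z D" "typed \<Gamma> P Prop"
  shows "\<Gamma> \<triangleright> \<Delta> \<tturnstile> partial_pair D x z P \<cdot> x"
proof -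
  note tys = typed_intros typed_set_intros ty
  have "\<Gamma> \<triangleright> \<Delta> \<tturnstile> singleton D x \<cdot> x"
    by (rule entails_eq_mp[OF entails_eq_sym[OF singleton_eq[OF ty(1,1)]] entails_eqI[OF ty(1)]])
      (rule tys)+
  then have *: "\<Gamma> \<triangleright> \<Delta> \<tturnstile> singleton D x \<cdot> x \<^bold>\<or> singleton_if D z P \<cdot> x"
    by (rule entails_disjI1) (rule tys)+
  show ?thesis
    by (rule entails_eq_mp[OF entails_eq_sym[OF set_union_eq] *]) (rule tys)+
qed

lemma partial_pair_right:
  assumes "\<Gamma> \<triangleright> \<Delta> \<tturnstile> P" and ty: "typed \<Gamma> x D" "typed \<Gamma> z D" "typed \<Gamma> P Prop"
  shows "\<Gamma> \<triangleright> \<Delta> \<tturnstile> partial_pair D x z P \<cdot> z"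
proof -
  note tys = typed_intros typed_set_intros ty
  have "\<Gamma> \<triangleright> \<Delta> \<tturnstile> singleton_if D z P \<cdot> z"
    by (rule entails_eq_mp[OF entails_eq_sym[OF singleton_if_eq[OF ty(2,3,2)]]
          entails_conjI[OF entails_eqI[OF ty(2)] assms(1)]]) (rule tys)+
  then have *: "\<Gamma> \<triangleright> \<Delta> \<tturnstile> singleton D x \<cdot> z \<^bold>\<or> singleton_if D z P \<cdot> z"
    by (rule entails_disjI2) (rule tys)+
  show ?thesis
    by (rule entails_eq_mp[OF entails_eq_sym[OF set_union_eq] *]) (rule tys)+
qed

text \<open>The disjuncts that membership yields are still applications of set operations; a cut
  with their beta equations replaces them by the usable conditions.\<close>

lemma partial_pair_cases:
  assumes "\<Gamma> \<triangleright> \<Delta> \<tturnstile> partial_pair D x z P \<cdot> w"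
    and "\<Gamma> \<triangleright> (w \<^bold>= x) # \<Delta> \<tturnstile> \<chi>" "\<Gamma> \<triangleright> (w \<^bold>= z \<^bold>\<and> P) # \<Delta> \<tturnstile> \<chi>"
    and ty: "typed \<Gamma> x D" "typed \<Gamma> z D" "typed \<Gamma> P Prop" "typed \<Gamma> w D"
  shows "\<Gamma> \<triangleright> \<Delta> \<tturnstile> \<chi>"
proof (rule entails_disjE)
  note tys = typed_intros typed_set_intros ty
  show "\<Gamma> \<triangleright> \<Delta> \<tturnstile> singleton D x \<cdot> w \<^bold>\<or> singleton_if D z P \<cdot> w"
    by (rule entails_eq_mp[OF set_union_eq assms(1)]) (rule tys)+
  show "\<Gamma> \<triangleright> singleton D x \<cdot> w # \<Delta> \<tturnstile> \<chi>"
  proof (rule entails_cut)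
    show "\<Gamma> \<triangleright> singleton D x \<cdot> w # \<Delta> \<tturnstile> w \<^bold>= x"
      by (rule entails_eq_mp[OF singleton_eq entails_hyp]) (rule tys | simp)+
    show "\<Gamma> \<triangleright> (w \<^bold>= x) # singleton D x \<cdot> w # \<Delta> \<tturnstile> \<chi>"
      by (rule entails_mono[OF assms(2)]) auto
  qed (rule tys)+
  show "\<Gamma> \<triangleright> singleton_if D z P \<cdot> w # \<Delta> \<tturnstile> \<chi>"
  proof (rule entails_cut)
    show "\<Gamma> \<triangleright> singleton_if D z P \<cdot> w # \<Delta> \<tturnstile> w \<^bold>= z \<^bold>\<and> P"
      by (rule entails_eq_mp[OF singleton_if_eq entails_hyp]) (rule tys | simp)+
    show "\<Gamma> \<triangleright> (w \<^bold>= z \<^bold>\<and> P) # singleton_if D z P \<cdot> w # \<Delta> \<tturnstile> \<chi>"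
      by (rule entails_mono[OF assms(3)]) auto
  qed (rule tys)+
  show "typed \<Gamma> (singleton D x \<cdot> w) Prop" "typed \<Gamma> (singleton_if D z P \<cdot> w) Prop"
    by (rule tys)+
qed

section \<open>Bounds, directedness and supremum of the set\<close>

lemma dcpo_poset: "\<Gamma> \<triangleright> \<Delta> \<tturnstile> dcpo D le \<Longrightarrow> \<Gamma> \<triangleright> \<Delta> \<tturnstile> poset D le"
  unfolding dcpo_def by (rule entails_conjE1)

lemma dcpo_sup:
  assumes "\<Gamma> \<triangleright> \<Delta> \<tturnstile> dcpo D le" "\<Gamma> \<triangleright> \<Delta> \<tturnstile> directed D le S"
    and ty: "typed \<Gamma> le (D \<rightarrow> D \<rightarrow> Prop)" "typed \<Gamma> S (D \<rightarrow> Prop)"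
  shows "\<Gamma> \<triangleright> \<Delta> \<tturnstile> (\<^bold>\<exists>z\<in>D. is_sup D le S z)"
proof -
  have "\<Gamma> \<triangleright> \<Delta> \<tturnstile> directed D le S \<^bold>\<longrightarrow> (\<^bold>\<exists>z\<in>D. is_sup D le S z)"
    by (rule entails_allE[OF entails_conjE2[OF assms(1)[unfolded dcpo_def]] ty(2)])
      (simp add: exp_defs directed_def is_sup_def ty[THEN typed_Suc])
  from entails_impE[OF this assms(2)] show ?thesis .
qed

context
  fixes \<Gamma> D le x z P \<Delta>
  assumes ty: "typed \<Gamma> le (D \<rightarrow> D \<rightarrow> Prop)" "typed \<Gamma> x D" "typed \<Gamma> z D" "typed \<Gamma> P Prop"
    and hyps: "dcpo D le \<in> set \<Delta>" "le \<cdot> x \<cdot> z \<in> set \<Delta>"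
begin

text \<open>By reflexivity if \<open>w\<close> is \<open>x\<close>, and by \<open>x\<close> being
  below \<open>z\<close> if \<open>w\<close> is \<open>z\<close>. The assumptions are members of
  \<open>\<Delta>\<close> rather than consequences of it, so they remain available when
  \<open>\<Delta>\<close> is extended or a binder is passed.\<close>

lemma le_partial_pair:
  assumes "\<Gamma> \<triangleright> \<Delta> \<tturnstile> partial_pair D x z P \<cdot> w" "typed \<Gamma> w D"
  shows "\<Gamma> \<triangleright> \<Delta> \<tturnstile> le \<cdot> x \<cdot> w"
proof (rule partial_pair_cases[OF assms(1) _ _ ty(2-4) assms(2)])
  show "\<Gamma> \<triangleright> (w \<^bold>= x) # \<Delta> \<tturnstile> le \<cdot> x \<cdot> w"
    by (rule entails_eq_right[OF entails_hyp poset_refl[OF dcpo_poset[OF entails_hyp]]])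
      (rule ty assms(2) list.set_intros hyps)+
  show "\<Gamma> \<triangleright> (w \<^bold>= z \<^bold>\<and> P) # \<Delta> \<tturnstile> le \<cdot> x \<cdot> w"
    by (rule entails_eq_right[OF entails_conjE1[OF entails_hyp] entails_hyp])
      (rule ty assms(2) list.set_intros hyps)+
qed

text \<open>The same cases with reflexivity and the order hypothesis exchanged.\<close>

lemma partial_pair_le:
  assumes "\<Gamma> \<triangleright> \<Delta> \<tturnstile> partial_pair D x z P \<cdot> w" "typed \<Gamma> w D"
  shows "\<Gamma> \<triangleright> \<Delta> \<tturnstile> le \<cdot> w \<cdot> z"
proof (rule partial_pair_cases[OF assms(1) _ _ ty(2-4) assms(2)])
  show "\<Gamma> \<triangleright> (w \<^bold>= x) # \<Delta> \<tturnstile> le \<cdot> w \<cdot> z"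
    by (rule entails_eq_left[OF entails_hyp entails_hyp])
      (rule ty assms(2) list.set_intros hyps)+
  show "\<Gamma> \<triangleright> (w \<^bold>= z \<^bold>\<and> P) # \<Delta> \<tturnstile> le \<cdot> w \<cdot> z"
    by (rule entails_eq_left[OF entails_conjE1[OF entails_hyp]
          poset_refl[OF dcpo_poset[OF entails_hyp]]])
      (rule ty assms(2) list.set_intros hyps)+
qed

end

text \<open>A case distinction on one of the two elements suffices, and \<open>P\<close> is never
  decided. If \<open>a = x\<close>, then \<open>b\<close> is an upper bound of both, since
  \<open>x\<close> is below every element; if \<open>a = z\<close>, then \<open>a\<close> is one,
  since every element is below \<open>z\<close>.\<close>

lemma partial_pair_directed:
  assumes ty: "typed \<Gamma> le (D \<rightarrow> D \<rightarrow> Prop)" "typed \<Gamma> x D" "typed \<Gamma> z D" "typed \<Gamma> P Prop"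
    and hyps: "dcpo D le \<in> set \<Delta>" "le \<cdot> x \<cdot> z \<in> set \<Delta>"
  shows "\<Gamma> \<triangleright> \<Delta> \<tturnstile> directed D le (partial_pair D x z P)"
  unfolding directed_def
proof (rule entails_conjI)
  let ?S = "partial_pair D x z P"
  note tyS = typed_partial_pair[OF ty(2-4)]
  show "\<Gamma> \<triangleright> \<Delta> \<tturnstile> (\<^bold>\<exists>x\<in>D. ?S \<cdot> x)"
    by (rule entails_exI[where F = "\<lambda>x. ?S \<cdot> x", OF partial_pair_left[OF ty(2-4)] ty(2)])
      (rule typed_intros tyS ty typed_weaken
        | simp add: exp_defs set_union_def singleton_def singleton_if_def ty[THEN typed_Suc])+
  let ?a = "var (length \<Gamma>)" and ?b = "var (length (D # \<Gamma>))"
  let ?\<Gamma> = "D # D # \<Gamma>" and ?\<Delta> = "?S \<cdot> ?b # ?S \<cdot> ?a # \<Delta>"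
  let ?ub = "\<lambda>c. ?S \<cdot> c \<^bold>\<and> le \<cdot> ?a \<cdot> c \<^bold>\<and> le \<cdot> ?b \<cdot> c"
  have a: "typed ?\<Gamma> ?a D" and b: "typed ?\<Gamma> ?b D"
    by (rule typed_weaken typed_var)+
  note ty' = ty[THEN typed_weaken, THEN typed_weaken]
  \<comment> \<open>Kept general in the witness and the hypotheses, because the two cases choose
    \<open>b\<close> and \<open>a\<close> respectively.\<close>
  have ub: "?\<Gamma> \<triangleright> \<Delta>' \<tturnstile> (\<^bold>\<exists>c\<in>D. ?ub c)"
    if "?\<Gamma> \<triangleright> \<Delta>' \<tturnstile> ?ub c" and c: "typed ?\<Gamma> c D" for c \<Delta>'
    by (rule entails_exI[where F = ?ub, OF that])
      (rule typed_intros tyS ty a b typed_weaken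
        | simp add: exp_defs set_union_def singleton_def singleton_if_def
            ty[THEN typed_Suc] c[THEN typed_Suc])+
  have *: "?\<Gamma> \<triangleright> ?\<Delta> \<tturnstile> (\<^bold>\<exists>c\<in>D. ?ub c)"
  proof (rule partial_pair_cases[OF entails_hyp _ _ ty'(2-4) a])
    show "?S \<cdot> ?a \<in> set ?\<Delta>" by simp
    show "?\<Gamma> \<triangleright> (?a \<^bold>= x) # ?\<Delta> \<tturnstile> (\<^bold>\<exists>c\<in>D. ?ub c)"
    proof (rule ub[OF _ b], intro entails_conjI)
      show S: "?\<Gamma> \<triangleright> (?a \<^bold>= x) # ?\<Delta> \<tturnstile> ?S \<cdot> ?b"
        by (rule entails_hyp) simp
      have "?\<Gamma> \<triangleright> (?a \<^bold>= x) # ?\<Delta> \<tturnstile> le \<cdot> x \<cdot> ?b"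
        by (rule le_partial_pair[OF ty' _ _ S b]) (simp_all add: hyps)
      with _ show "?\<Gamma> \<triangleright> (?a \<^bold>= x) # ?\<Delta> \<tturnstile> le \<cdot> ?a \<cdot> ?b"
        by (rule entails_eq_left[OF entails_hyp]) (rule list.set_intros a b ty')+
      show "?\<Gamma> \<triangleright> (?a \<^bold>= x) # ?\<Delta> \<tturnstile> le \<cdot> ?b \<cdot> ?b"
        by (rule poset_refl[OF dcpo_poset[OF entails_hyp] ty'(1) b]) (simp add: hyps)
    qed
    show "?\<Gamma> \<triangleright> (?a \<^bold>= z \<^bold>\<and> P) # ?\<Delta> \<tturnstile> (\<^bold>\<exists>c\<in>D. ?ub c)"
    proof (rule ub[OF _ a], intro entails_conjI)
      show "?\<Gamma> \<triangleright> (?a \<^bold>= z \<^bold>\<and> P) # ?\<Delta> \<tturnstile> ?S \<cdot> ?a"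
        by (rule entails_hyp) simp
      show "?\<Gamma> \<triangleright> (?a \<^bold>= z \<^bold>\<and> P) # ?\<Delta> \<tturnstile> le \<cdot> ?a \<cdot> ?a"
        by (rule poset_refl[OF dcpo_poset[OF entails_hyp] ty'(1) a]) (simp add: hyps)
      have "?\<Gamma> \<triangleright> (?a \<^bold>= z \<^bold>\<and> P) # ?\<Delta> \<tturnstile> le \<cdot> ?b \<cdot> z"
        by (rule partial_pair_le[OF ty' _ _ entails_hyp b]) (simp_all add: hyps)
      with _ show "?\<Gamma> \<triangleright> (?a \<^bold>= z \<^bold>\<and> P) # ?\<Delta> \<tturnstile> le \<cdot> ?b \<cdot> ?a"
        by (rule entails_eq_right[OF entails_conjE1[OF entails_hyp]])
          (rule list.set_intros a b ty')+
    qed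
  qed
  show "\<Gamma> \<triangleright> \<Delta> \<tturnstile> (\<^bold>\<forall>a\<in>D. \<^bold>\<forall>b\<in>D. ?S \<cdot> a \<^bold>\<longrightarrow> ?S \<cdot> b \<^bold>\<longrightarrow>
      (\<^bold>\<exists>c\<in>D. ?S \<cdot> c \<^bold>\<and> le \<cdot> a \<cdot> c \<^bold>\<and> le \<cdot> b \<cdot> c))"
    by (intro entails_allI entails_impI *) (rule typed_App tyS a b typed_weaken)+
qed

text \<open>\<open>P\<close> puts \<open>z\<close> into the set, so \<open>z\<close> is below
  \<open>s\<close>; and \<open>z\<close> is an upper bound of the set in any case, so
  \<open>s\<close> is below \<open>z\<close>.\<close>

lemma sup_partial_pair_top:
  assumes "\<Gamma> \<triangleright> \<Delta> \<tturnstile> is_sup D le (partial_pair D x z P) s" "\<Gamma> \<triangleright> \<Delta> \<tturnstile> P"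
    and ty: "typed \<Gamma> le (D \<rightarrow> D \<rightarrow> Prop)" "typed \<Gamma> x D" "typed \<Gamma> z D" "typed \<Gamma> P Prop" "typed \<Gamma> s D"
    and hyps: "dcpo D le \<in> set \<Delta>" "le \<cdot> x \<cdot> z \<in> set \<Delta>"
  shows "\<Gamma> \<triangleright> \<Delta> \<tturnstile> z \<^bold>= s"
proof (rule poset_antisym[OF dcpo_poset[OF entails_hyp[OF hyps(1)]] _ _ ty(1,3,5)])
  note tyS = typed_partial_pair[OF ty(2-4)]
  show "\<Gamma> \<triangleright> \<Delta> \<tturnstile> le \<cdot> z \<cdot> s"
    by (rule is_sup_upper[OF assms(1) partial_pair_right[OF assms(2)]]) (rule tyS ty)+
  show "\<Gamma> \<triangleright> \<Delta> \<tturnstile> le \<cdot> s \<cdot> z"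
  proof (rule is_sup_least[OF assms(1)])
    show "D # \<Gamma> \<triangleright> partial_pair D x z P \<cdot> var (length \<Gamma>) # \<Delta> \<tturnstile> le \<cdot> var (length \<Gamma>) \<cdot> z"
      by (rule partial_pair_le[OF ty(1-4)[THEN typed_weaken] _ _ entails_hyp typed_var])
        (simp_all add: hyps)
  qed (rule tyS ty)+
qed

text \<open>With \<open>P\<close> refuted every element of the set equals \<open>x\<close>, so
  \<open>s\<close> is below \<open>x\<close>; the converse holds because \<open>x\<close> is a
  member.\<close>

lemma sup_partial_pair_bot:
  assumes "\<Gamma> \<triangleright> \<Delta> \<tturnstile> is_sup D le (partial_pair D x z P) s"
    and ty: "typed \<Gamma> le (D \<rightarrow> D \<rightarrow> Prop)" "typed \<Gamma> x D" "typed \<Gamma> z D" "typed \<Gamma> P Prop" "typed \<Gamma> s D"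
    and hyps: "dcpo D le \<in> set \<Delta>" "(\<^bold>\<not> P) \<in> set \<Delta>"
  shows "\<Gamma> \<triangleright> \<Delta> \<tturnstile> x \<^bold>= s"
proof (rule poset_antisym[OF dcpo_poset[OF entails_hyp[OF hyps(1)]] _ _ ty(1,2,5)])
  let ?S = "partial_pair D x z P" and ?w = "var (length \<Gamma>)"
  note tyS = typed_partial_pair[OF ty(2-4)]
  show "\<Gamma> \<triangleright> \<Delta> \<tturnstile> le \<cdot> x \<cdot> s"
    by (rule is_sup_upper[OF assms(1) partial_pair_left]) (rule tyS ty)+
  show "\<Gamma> \<triangleright> \<Delta> \<tturnstile> le \<cdot> s \<cdot> x"
  proof (rule is_sup_least[OF assms(1)])
    note ty' = ty[THEN typed_weaken]
    show "D # \<Gamma> \<triangleright> ?S \<cdot> ?w # \<Delta> \<tturnstile> le \<cdot> ?w \<cdot> x"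
    proof (rule partial_pair_cases[OF entails_hyp _ _ ty'(2-4) typed_var])
      show "?S \<cdot> ?w \<in> set (?S \<cdot> ?w # \<Delta>)" by simp
      show "D # \<Gamma> \<triangleright> (?w \<^bold>= x) # ?S \<cdot> ?w # \<Delta> \<tturnstile> le \<cdot> ?w \<cdot> x"
        by (rule entails_eq_left[OF entails_hyp poset_refl[OF dcpo_poset[OF entails_hyp]]])
          (rule list.set_intros hyps typed_var ty')+
      \<comment> \<open>The conjunct \<open>P\<close> of this case contradicts the hypothesis
        \<open>\<not> P\<close>.\<close>
      show "D # \<Gamma> \<triangleright> (?w \<^bold>= z \<^bold>\<and> P) # ?S \<cdot> ?w # \<Delta> \<tturnstile> le \<cdot> ?w \<cdot> x"
        by (rule entails_FlsE[OF entails_notE[OF entails_hyp entails_conjE2[OF entails_hyp]]])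
          (rule list.set_intros hyps typed_App typed_var ty')+
    qed
  qed (rule tyS ty)+
qed

text \<open>Completeness as an elimination rule: a supremum may be named while deriving
  \<open>\<chi>\<close>, because \<open>\<chi>\<close> is typed without it.\<close>

lemma partial_pair_sup:
  assumes "D # \<Gamma> \<triangleright> is_sup D le (partial_pair D x z P) (var (length \<Gamma>)) # \<Delta> \<tturnstile> \<chi>"
    and ty: "typed \<Gamma> le (D \<rightarrow> D \<rightarrow> Prop)" "typed \<Gamma> x D" "typed \<Gamma> z D" "typed \<Gamma> P Prop" "typed \<Gamma> \<chi> Prop"
    and hyps: "dcpo D le \<in> set \<Delta>" "le \<cdot> x \<cdot> z \<in> set \<Delta>"
  shows "\<Gamma> \<triangleright> \<Delta> \<tturnstile> \<chi>"
proof (rule entails_exE)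
  show "\<Gamma> \<triangleright> \<Delta> \<tturnstile> (\<^bold>\<exists>s\<in>D. is_sup D le (partial_pair D x z P) s)"
    by (rule dcpo_sup[OF entails_hyp partial_pair_directed]) (rule typed_set_intros ty hyps)+
  show "D # \<Gamma> \<triangleright> is_sup D le (partial_pair D x z P) (var (length \<Gamma>)) # \<Delta> \<tturnstile> \<chi>"
    by (rule assms(1))
qed (rule typed_is_sup typed_set_intros ty typed_var typed_weaken)+


section \<open>Tightness and cotransitivity\<close>

lemma tight_dne:
  assumes ty: "typed \<Gamma> le (D \<rightarrow> D \<rightarrow> Prop)" "typed \<Gamma> ap (D \<rightarrow> D \<rightarrow> Prop)"
      "typed \<Gamma> x D" "typed \<Gamma> y D" "typed \<Gamma> P Prop"
    and hyps: "dcpo D le \<in> set \<Delta>" "apartness D ap \<in> set \<Delta>" "tight D ap \<in> set \<Delta>"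
      "strictly_below D le x y \<in> set \<Delta>"
  shows "\<Gamma> \<triangleright> \<Delta> \<tturnstile> \<^bold>\<not> \<^bold>\<not> P \<^bold>\<longrightarrow> P"
proof (rule entails_impI, rule entails_cut)
  let ?S = "partial_pair D x y P" and ?s = "var (length \<Gamma>)"
  show "\<Gamma> \<triangleright> (\<^bold>\<not> \<^bold>\<not> P) # \<Delta> \<tturnstile> le \<cdot> x \<cdot> y"
    by (rule strictly_below_le[OF entails_hyp]) (rule list.set_intros hyps)+
  \<comment> \<open>\<open>\<Delta>1\<close> holds the hypotheses before the supremum
    \<open>s\<close> is named, \<open>\<Delta>2\<close> those afterwards, one binder deeper.\<close>
  define \<Delta>1 where "\<Delta>1 = le \<cdot> x \<cdot> y # (\<^bold>\<not> \<^bold>\<not> P) # \<Delta>"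
  define \<Delta>2 where "\<Delta>2 = is_sup D le ?S ?s # \<Delta>1"
  note ty' = ty[THEN typed_weaken] typed_var[of D \<Gamma>]
  note tyS = typed_partial_pair[OF ty'(3-5)]
  have hyps2: "dcpo D le \<in> set \<Delta>2" "apartness D ap \<in> set \<Delta>2" "tight D ap \<in> set \<Delta>2"
    "strictly_below D le x y \<in> set \<Delta>2" "le \<cdot> x \<cdot> y \<in> set \<Delta>2" "(\<^bold>\<not> \<^bold>\<not> P) \<in> set \<Delta>2"
    "is_sup D le ?S ?s \<in> set \<Delta>2"
    by (simp_all add: \<Delta>2_def \<Delta>1_def hyps)
  \<comment> \<open>If \<open>P\<close> holds, then \<open>s\<close> is \<open>y\<close>, and
    \<open>y \<sharp> s\<close> becomes \<open>y \<sharp> y\<close>.\<close>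
  have "D # \<Gamma> \<triangleright> P # ap \<cdot> y \<cdot> ?s # \<Delta>2 \<tturnstile> \<^bold>\<bottom>"
  proof (rule apartness_irrefl[OF entails_hyp _ ty'(2,4)])
    have "D # \<Gamma> \<triangleright> P # ap \<cdot> y \<cdot> ?s # \<Delta>2 \<tturnstile> y \<^bold>= ?s"
      by (rule sup_partial_pair_top[OF entails_hyp entails_hyp ty'(1,3-6)]) (simp_all add: hyps2)
    then show "D # \<Gamma> \<triangleright> P # ap \<cdot> y \<cdot> ?s # \<Delta>2 \<tturnstile> ap \<cdot> y \<cdot> y"
      by (rule entails_eq_right[OF _ entails_hyp]) (rule ty' list.set_intros)+
  qed (simp add: hyps2)
  then have "D # \<Gamma> \<triangleright> ap \<cdot> y \<cdot> ?s # \<Delta>2 \<tturnstile> \<^bold>\<not> P"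
    by (rule entails_notI[OF _ ty'(5)])
  \<comment> \<open>So \<open>y \<sharp> s\<close> refutes \<open>P\<close>, against
    \<open>\<not>\<not> P\<close>; hence \<open>y\<close> and \<open>s\<close> are not apart, and
    tightness applies.\<close>
  then have "D # \<Gamma> \<triangleright> ap \<cdot> y \<cdot> ?s # \<Delta>2 \<tturnstile> \<^bold>\<bottom>"
    by (rule entails_notE[OF entails_hyp, rotated]) (simp add: hyps2)
  then have "D # \<Gamma> \<triangleright> \<Delta>2 \<tturnstile> \<^bold>\<not> ap \<cdot> y \<cdot> ?s"
    by (rule entails_notI) (rule typed_App ty')+
  then have "D # \<Gamma> \<triangleright> \<Delta>2 \<tturnstile> y \<^bold>= ?s"
    by (rule tight_eq[OF entails_hyp[OF hyps2(3)] _ ty'(2,4,6)])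
  then have "D # \<Gamma> \<triangleright> \<Delta>2 \<tturnstile> ?s \<^bold>= y"
    by (rule entails_eq_sym[OF _ ty'(4,6)])
  \<comment> \<open>Strictness asks for the supremum to be an element above \<open>y\<close>, here
    \<open>y\<close> itself, so the property is moved from \<open>s\<close> to
    \<open>y\<close>.\<close>
  then have sup: "D # \<Gamma> \<triangleright> \<Delta>2 \<tturnstile> is_sup D le ?S y"
    by (rule is_sup_eq[OF _ entails_hyp[OF hyps2(7)]]) (rule ty' tyS)+
  have "D # \<Gamma> \<triangleright> \<Delta>2 \<tturnstile> P"
    by (rule strictly_below_sup[OF entails_hyp poset_refl[OF dcpo_poset[OF entails_hyp]] sup])
      (rule hyps2 ty')+
  then have "\<Gamma> \<triangleright> \<Delta>1 \<tturnstile> P"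
    unfolding \<Delta>2_def by (rule partial_pair_sup) (rule ty | simp add: \<Delta>1_def hyps)+
  then show "\<Gamma> \<triangleright> le \<cdot> x \<cdot> y # (\<^bold>\<not> \<^bold>\<not> P) # \<Delta> \<tturnstile> P"
    by (simp add: \<Delta>1_def)
qed (rule typed_intros ty)+

text \<open>\<open>tight_dne\<close> is applied below the quantifier over \<open>P\<close> and at a
  compound formula, which is why it was proved for an arbitrary context and an arbitrary typed
  proposition.\<close>

lemma tight_excluded_middle:
  assumes ty: "typed \<Gamma> le (D \<rightarrow> D \<rightarrow> Prop)" "typed \<Gamma> ap (D \<rightarrow> D \<rightarrow> Prop)" "typed \<Gamma> x D" "typed \<Gamma> y D"
    and hyps: "dcpo D le \<in> set \<Delta>" "apartness D ap \<in> set \<Delta>" "tight D ap \<in> set \<Delta>"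
      "strictly_below D le x y \<in> set \<Delta>"
  shows "\<Gamma> \<triangleright> \<Delta> \<tturnstile> excluded_middle"
  unfolding excluded_middle_def
proof (rule entails_allI, rule entails_impE)
  let ?P = "var (length \<Gamma>)"
  note tys = typed_intros ty typed_weaken
  have P: "typed (Prop # \<Gamma>) ?P Prop" by (rule typed_var)
  show "Prop # \<Gamma> \<triangleright> \<Delta> \<tturnstile> \<^bold>\<not> \<^bold>\<not> (?P \<^bold>\<or> \<^bold>\<not> ?P) \<^bold>\<longrightarrow> ?P \<^bold>\<or> \<^bold>\<not> ?P"
    by (rule tight_dne[OF ty[THEN typed_weaken] _ hyps]) (rule tys)+
  let ?\<Delta> = "(\<^bold>\<not> (?P \<^bold>\<or> \<^bold>\<not> ?P)) # \<Delta>"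
  \<comment> \<open>Intuitionistic proof of the double negation: under
    \<open>\<not> (P \<or> \<not> P)\<close> the proposition \<open>P\<close> is absurd, which gives
    \<open>\<not> P\<close> and thereby a contradiction again.\<close>
  have "Prop # \<Gamma> \<triangleright> ?P # ?\<Delta> \<tturnstile> ?P \<^bold>\<or> \<^bold>\<not> ?P"
    by (rule entails_disjI1[OF entails_hyp]) (rule tys | simp)+
  then have "Prop # \<Gamma> \<triangleright> ?P # ?\<Delta> \<tturnstile> \<^bold>\<bottom>"
    by (rule entails_notE[OF entails_hyp, rotated]) simp
  then have "Prop # \<Gamma> \<triangleright> ?\<Delta> \<tturnstile> ?P \<^bold>\<or> \<^bold>\<not> ?P"
    by (intro entails_disjI2 entails_notI P)
  then have "Prop # \<Gamma> \<triangleright> ?\<Delta> \<tturnstile> \<^bold>\<bottom>"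
    by (rule entails_notE[OF entails_hyp, rotated]) simp
  then show "Prop # \<Gamma> \<triangleright> \<Delta> \<tturnstile> \<^bold>\<not> \<^bold>\<not> (?P \<^bold>\<or> \<^bold>\<not> ?P)"
    by (rule entails_notI) (rule tys)+
qed

lemma cotransitive_weak_excluded_middle:
  assumes ty0: "typed \<Gamma> le (D \<rightarrow> D \<rightarrow> Prop)" "typed \<Gamma> ap (D \<rightarrow> D \<rightarrow> Prop)" "typed \<Gamma> x D" "typed \<Gamma> y D"
    and hyps: "dcpo D le \<in> set \<Delta>" "apartness D ap \<in> set \<Delta>" "cotransitive D ap \<in> set \<Delta>"
      "le \<cdot> x \<cdot> y \<in> set \<Delta>" "ap \<cdot> x \<cdot> y \<in> set \<Delta>"
  shows "\<Gamma> \<triangleright> \<Delta> \<tturnstile> weak_excluded_middle"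
  unfolding weak_excluded_middle_def
proof (rule entails_allI, rule partial_pair_sup)
  let ?P = "var (length \<Gamma>)" and ?s = "var (length (Prop # \<Gamma>))"
  let ?S = "partial_pair D x y ?P"
  let ?\<Gamma> = "D # Prop # \<Gamma>" and ?\<Delta> = "is_sup D le (partial_pair D x y ?P) ?s # \<Delta>"
  let ?goal = "\<^bold>\<not> ?P \<^bold>\<or> \<^bold>\<not> \<^bold>\<not> ?P"
  note ty1 = ty0[THEN typed_weaken] typed_var[of Prop \<Gamma>]
  note ty = ty1[THEN typed_weaken] typed_var[of D "Prop # \<Gamma>"]
  show "?\<Gamma> \<triangleright> ?\<Delta> \<tturnstile> ?goal"
  proof (rule entails_disjE)
    show "?\<Gamma> \<triangleright> ?\<Delta> \<tturnstile> ap \<cdot> x \<cdot> ?s \<^bold>\<or> ap \<cdot> y \<cdot> ?s"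
      by (rule cotransitive_cases[OF entails_hyp entails_hyp ty(2-4,6)]) (simp_all add: hyps)
    \<comment> \<open>Under \<open>\<not> P\<close> the supremum is \<open>x\<close>, so
      \<open>x \<sharp> s\<close> becomes \<open>x \<sharp> x\<close>. This refutes
      \<open>\<not> P\<close> without proving \<open>P\<close>, and so yields the second disjunct of
      the weak principle.\<close>
    have "?\<Gamma> \<triangleright> (\<^bold>\<not> ?P) # ap \<cdot> x \<cdot> ?s # ?\<Delta> \<tturnstile> \<^bold>\<bottom>"
    proof (rule apartness_irrefl[OF entails_hyp _ ty(2,3)])
      have "?\<Gamma> \<triangleright> (\<^bold>\<not> ?P) # ap \<cdot> x \<cdot> ?s # ?\<Delta> \<tturnstile> x \<^bold>= ?s"
        by (rule sup_partial_pair_bot[OF entails_hyp ty(1,3-6)]) (simp_all add: hyps)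
      then show "?\<Gamma> \<triangleright> (\<^bold>\<not> ?P) # ap \<cdot> x \<cdot> ?s # ?\<Delta> \<tturnstile> ap \<cdot> x \<cdot> x"
        by (rule entails_eq_right[OF _ entails_hyp]) (rule ty list.set_intros)+
    qed (simp add: hyps)
    then show "?\<Gamma> \<triangleright> ap \<cdot> x \<cdot> ?s # ?\<Delta> \<tturnstile> ?goal"
      by (intro entails_disjI2 entails_notI typed_Not ty)
    \<comment> \<open>Under \<open>P\<close> the supremum is \<open>y\<close>, so
      \<open>y \<sharp> s\<close> becomes \<open>y \<sharp> y\<close>, which yields
      \<open>\<not> P\<close>.\<close>
    have "?\<Gamma> \<triangleright> ?P # ap \<cdot> y \<cdot> ?s # ?\<Delta> \<tturnstile> \<^bold>\<bottom>"
    proof (rule apartness_irrefl[OF entails_hyp _ ty(2,4)])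
      have "?\<Gamma> \<triangleright> ?P # ap \<cdot> y \<cdot> ?s # ?\<Delta> \<tturnstile> y \<^bold>= ?s"
        by (rule sup_partial_pair_top[OF entails_hyp entails_hyp ty(1,3-6)]) (simp_all add: hyps)
      then show "?\<Gamma> \<triangleright> ?P # ap \<cdot> y \<cdot> ?s # ?\<Delta> \<tturnstile> ap \<cdot> y \<cdot> y"
        by (rule entails_eq_right[OF _ entails_hyp]) (rule ty list.set_intros)+
    qed (simp add: hyps)
    then show "?\<Gamma> \<triangleright> ap \<cdot> y \<cdot> ?s # ?\<Delta> \<tturnstile> ?goal"
      by (intro entails_disjI1 entails_notI typed_Not ty)
  qed (rule typed_App ty)+
qed (rule typed_intros hyps ty0 typed_weaken)+

theorem theorem5p6:
  fixes D :: ty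
  shows "\<turnstile> (\<^bold>\<forall>le\<in>D \<rightarrow> D \<rightarrow> Prop. \<^bold>\<forall>ap\<in>D \<rightarrow> D \<rightarrow> Prop.
    dcpo D le \<^bold>\<longrightarrow> apartness D ap \<^bold>\<longrightarrow>
      ((\<^bold>\<exists>x\<in>D. \<^bold>\<exists>y\<in>D. strictly_below D le x y) \<^bold>\<longrightarrow>
        tight D ap \<^bold>\<longrightarrow> excluded_middle)
      \<^bold>\<and> ((\<^bold>\<exists>x\<in>D. \<^bold>\<exists>y\<in>D. le \<cdot> x \<cdot> y \<^bold>\<and> ap \<cdot> x \<cdot> y) \<^bold>\<longrightarrow>
        cotransitive D ap \<^bold>\<longrightarrow> weak_excluded_middle))"
proof -
  let ?R = "D \<rightarrow> D \<rightarrow> Prop"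
  let ?\<Gamma> = "[?R, ?R]" and ?\<Gamma>' = "[D, D, ?R, ?R]"
  \<comment> \<open>Each variable is written in the form that the quantifier rules produce, with the
    length of the context in which its quantifier is opened.\<close>
  let ?le = "var (length ([] :: ty list))" and ?ap = "var (length [?R])"
    and ?x = "var (length [?R, ?R])" and ?y = "var (length [D, ?R, ?R])"
  have ty: "typed ?\<Gamma>' ?le ?R" "typed ?\<Gamma>' ?ap ?R" "typed ?\<Gamma>' ?x D" "typed ?\<Gamma>' ?y D"
    by (rule typed_var typed_weaken)+
  note tys = typed_intros typed_excluded_middle typed_weak_excluded_middle typed_dcpo
    typed_apartness typed_strictly_below typed_tight typed_cotransitive typed_weaken
  note uniform = exp_defs strictly_below_def is_sup_def set_union_def singleton_def singleton_if_def
  let ?\<Delta> = "[apartness D ?ap, dcpo D ?le]"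
  \<comment> \<open>Contexts list the innermost variable first: \<open>y\<close>, \<open>x\<close>,
    the apartness, the order. The conclusion mentions none of them, so the existential quantifiers
    over \<open>x\<close> and \<open>y\<close> can be eliminated afterwards.\<close>
  have "?\<Gamma>' \<triangleright> tight D ?ap # strictly_below D ?le ?x ?y # ?\<Delta> \<tturnstile> excluded_middle"
    by (rule tight_excluded_middle[OF ty]) (rule list.set_intros)+
  then have em: "?\<Gamma> \<triangleright> ?\<Delta> \<tturnstile> (\<^bold>\<exists>x\<in>D. \<^bold>\<exists>y\<in>D. strictly_below D ?le x y) \<^bold>\<longrightarrow>
      tight D ?ap \<^bold>\<longrightarrow> excluded_middle"
    by (intro entails_impI entails_exL) (rule tys | simp add: uniform)+
  have "?\<Gamma>' \<triangleright> cotransitive D ?ap # ?le \<cdot> ?x \<cdot> ?y # ?ap \<cdot> ?x \<cdot> ?y # ?\<Delta> \<tturnstile> weak_excluded_middle"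
    by (rule cotransitive_weak_excluded_middle[OF ty]) (rule list.set_intros)+
  then have wem: "?\<Gamma> \<triangleright> ?\<Delta> \<tturnstile> (\<^bold>\<exists>x\<in>D. \<^bold>\<exists>y\<in>D. ?le \<cdot> x \<cdot> y \<^bold>\<and> ?ap \<cdot> x \<cdot> y) \<^bold>\<longrightarrow>
      cotransitive D ?ap \<^bold>\<longrightarrow> weak_excluded_middle"
    by (intro entails_impI entails_exL entails_conjL) (rule tys | simp add: uniform)+
  have "[] \<triangleright> [] \<tturnstile> (\<^bold>\<forall>le\<in>?R. \<^bold>\<forall>ap\<in>?R. dcpo D le \<^bold>\<longrightarrow> apartness D ap \<^bold>\<longrightarrow>
      ((\<^bold>\<exists>x\<in>D. \<^bold>\<exists>y\<in>D. strictly_below D le x y) \<^bold>\<longrightarrow>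
        tight D ap \<^bold>\<longrightarrow> excluded_middle)
      \<^bold>\<and> ((\<^bold>\<exists>x\<in>D. \<^bold>\<exists>y\<in>D. le \<cdot> x \<cdot> y \<^bold>\<and> ap \<cdot> x \<cdot> y) \<^bold>\<longrightarrow>
        cotransitive D ap \<^bold>\<longrightarrow> weak_excluded_middle))"
    by (rule entails_allI, rule entails_allI, rule entails_impI, rule entails_impI,
        rule entails_conjI[OF em wem]) (rule tys)+
  \<comment> \<open>At depth 0 and without hypotheses the typing premise is vacuous, and entailment
    is derivability of the sentence.\<close>
  then show ?thesis
    by (simp add: holds_def entails_def)
qed

end
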